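(* Let $p\in(1,+\infty)$. For every open bounded domain $\Omega$ in $\mathbb{R}^n$, the first Dirichlet eigenvalue $\overline\lambda_p(\Omega)$ of the normalized $p$-Laplacian satisfies the lower bound $$\overline\lambda_p(\Omega)\ \ge\ K_{n,p}\,|\Omega|^{-2/n},$$ where $|\Omega|$ is the Lebesgue measure of $\Omega$ and $$K_{n,p}:=\frac{\big(n[(p-1)\wedge1]\big)^2}{p(p-1)}\;4^{-1+1/n}\;\pi^{1+1/n}\;\Gamma\Big(\frac{n+1}{2}\Big)^{-2/n}.$$
   Context: Here $a\wedge b=\min\{a,b\}$ and $\Gamma$ is the Euler Gamma function. For $p\in(1,+\infty)$, the normalized (game-theoretic) $p$-Laplacian is, where $\nabla u\neq 0$, $$\Delta_p^N u=\frac{p-2}{p}|\nabla u|^{-2}\langle \nabla^2u\,\nabla u,\nabla u\rangle+\frac1p\,\mathrm{Tr}(\nabla^2u).$$ For a symmetric matrix $A$, let $M(A)$ and $m(A)$ be its greatest and smallest eigenvalue. A lower semicontinuous function $u:\Omega\to\mathbb{R}$ is a viscosity supersolution of $-\Delta_p^N u=\lambda_p u$ in $\Omega$ (equivalently, $\Delta_p^N u+\lambda_p u\le0$ in the viscosity sense) if, for every $x\in\Omega$ and every smooth $\varphi$ touching $u$ from below at $x$ (so $\varphi(x)=u(x)$ and $u-\varphi$ has a local minimum at $x$): (a) if $\nabla\varphi(x)\ne0$, then $-\Delta_p^N\varphi(x)\ge\lambda_p\varphi(x)$; (b) if $\nabla\varphi(x)=0$ and $p\ge2$, then $-\frac1p\Delta\varphi(x)-\frac{p-2}{p}m(D^2\varphi(x))\ge\lambda_p\varphi(x)$;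 (c) if $\nabla\varphi(x)=0$ and $p\le2$, then $-\frac1p\Delta\varphi(x)-\frac{p-2}{p}M(D^2\varphi(x))\ge\lambda_p\varphi(x)$. The first eigenvalue of $\Delta_p^N$ in $\Omega$ is $$\overline\lambda_p(\Omega):=\sup\{\lambda_p\in\mathbb{R}:\ \exists\,u>0\text{ in }\Omega\text{ such that }\Delta_p^N u+\lambda_p u\le0\text{ in }\Omega\text{ in the viscosity sense}\}.$$ *)

theory Defs
  imports "HOL-Analysis.Analysis"
begin

definition partial_deriv :: "'n::finite \<Rightarrow> (real^'n \<Rightarrow> real) \<Rightarrow> real^'n \<Rightarrow> real" where
  "partial_deriv i f x = frechet_derivative f (at x) (axis i 1)"

text \<open>On an open set \<open>S\<close>, \<open>C_k_on k S f\<close> is the usual \<open>f \<in> C\<^sup>k(S)\<close>: Frechet differentiability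
  together with all partial derivatives being \<open>C\<^sup>k\<^sup>-\<^sup>1\<close>.\<close>

primrec C_k_on :: "nat \<Rightarrow> (real^'n::finite) set \<Rightarrow> (real^'n \<Rightarrow> real) \<Rightarrow> bool" where
  "C_k_on 0 S f \<longleftrightarrow> continuous_on S f"
| "C_k_on (Suc k) S f \<longleftrightarrow>
     (\<forall>x\<in>S. f differentiable (at x)) \<and> (\<forall>i. C_k_on k S (partial_deriv i f))"

definition smooth_on :: "(real^'n::finite) set \<Rightarrow> (real^'n \<Rightarrow> real) \<Rightarrow> bool" where
  "smooth_on S f \<longleftrightarrow> (\<forall>k. C_k_on k S f)"

definition grad :: "(real^'n::finite \<Rightarrow> real) \<Rightarrow> real^'n \<Rightarrow> real^'n" where
  "grad f x = (\<chi> i. partial_deriv i f x)"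

definition hessian :: "(real^'n::finite \<Rightarrow> real) \<Rightarrow> real^'n \<Rightarrow> real^'n^'n" where
  "hessian f x = (\<chi> i j. partial_deriv i (partial_deriv j f) x)"

definition laplacian :: "(real^'n::finite \<Rightarrow> real) \<Rightarrow> real^'n \<Rightarrow> real" where
  "laplacian f x = trace (hessian f x)"

definition real_eigenvalues :: "real^'n^'n::finite \<Rightarrow> real set" where
  "real_eigenvalues A = {l. \<exists>v. v \<noteq> 0 \<and> A *v v = l *\<^sub>R v}"

text \<open>For a symmetric matrix \<open>real_eigenvalues\<close> is finite and nonempty, so \<open>Max\<close> and \<open>Min\<close> below
  are genuine. They are only applied to Hessians of smooth functions.\<close>

definition max_eigenvalue :: "real^'n^'n::finite \<Rightarrow> real" where
  "max_eigenvalue A = Max (real_eigenvalues A)"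

definition min_eigenvalue :: "real^'n^'n::finite \<Rightarrow> real" where
  "min_eigenvalue A = Min (real_eigenvalues A)"

text \<open>Only meaningful where \<open>grad f x \<noteq> 0\<close>.\<close>

definition normalized_p_laplacian :: "real \<Rightarrow> (real^'n::finite \<Rightarrow> real) \<Rightarrow> real^'n \<Rightarrow> real" where
  "normalized_p_laplacian p f x =
     (p - 2) / p * (((hessian f x *v grad f x) \<bullet> grad f x) / (norm (grad f x))\<^sup>2)
     + 1 / p * trace (hessian f x)"

definition lower_semicontinuous_on :: "'a::topological_space set \<Rightarrow> ('a \<Rightarrow> real) \<Rightarrow> bool" where
  "lower_semicontinuous_on S u \<longleftrightarrow> (\<forall>x\<in>S. \<forall>a<u x. eventually (\<lambda>y. a < u y) (at x within S))"

definition touches_from_below ::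
    "(real^'n::finite) set \<Rightarrow> (real^'n \<Rightarrow> real) \<Rightarrow> (real^'n \<Rightarrow> real) \<Rightarrow> real^'n \<Rightarrow> bool" where
  "touches_from_below \<Omega> \<phi> u x \<longleftrightarrow>
     \<phi> x = u x \<and> eventually (\<lambda>y. u x - \<phi> x \<le> u y - \<phi> y) (at x within \<Omega>)"

definition viscosity_supersolution ::
    "real \<Rightarrow> real \<Rightarrow> (real^'n::finite) set \<Rightarrow> (real^'n \<Rightarrow> real) \<Rightarrow> bool" where
  "viscosity_supersolution p l \<Omega> u \<longleftrightarrow>
     lower_semicontinuous_on \<Omega> u \<and>
     (\<forall>x\<in>\<Omega>. \<forall>\<phi>. smooth_on \<Omega> \<phi> \<and> touches_from_below \<Omega> \<phi> u x \<longrightarrow>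
        (grad \<phi> x \<noteq> 0 \<longrightarrow>
           - normalized_p_laplacian p \<phi> x \<ge> l * \<phi> x) \<and>
        (grad \<phi> x = 0 \<and> p \<ge> 2 \<longrightarrow>
           - (1 / p) * laplacian \<phi> x - (p - 2) / p * min_eigenvalue (hessian \<phi> x) \<ge> l * \<phi> x) \<and>
        (grad \<phi> x = 0 \<and> p \<le> 2 \<longrightarrow>
           - (1 / p) * laplacian \<phi> x - (p - 2) / p * max_eigenvalue (hessian \<phi> x) \<ge> l * \<phi> x))"

text \<open>The supremum is taken in the extended reals, so that it is well defined independently of
  whether the set is nonempty and bounded above.\<close>

definition first_eigenvalue :: "real \<Rightarrow> (real^'n::finite) set \<Rightarrow> ereal" where
  "first_eigenvalue p \<Omega> =
     Sup (ereal ` {l. \<exists>u. (\<forall>x\<in>\<Omega>. u x > 0) \<and> viscosity_supersolution p l \<Omega> u})"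

definition K_const :: "nat \<Rightarrow> real \<Rightarrow> real" where
  "K_const n p =
     (real n * min (p - 1) 1)\<^sup>2 / (p * (p - 1)) * 4 powr (- 1 + 1 / real n)
     * pi powr (1 + 1 / real n) * Gamma ((real n + 1) / 2) powr (- 2 / real n)"

end

theory Submission
  imports Defs "HOL-Complex_Analysis.Great_Picard" "HOL-Probability.Distributions"
begin

text \<open>
  The eigenvalue is a supremum over positive supersolutions, so for every
  \<open>0 < l < K \<bar>\<Omega>\<bar>\<^sup>-\<^sup>2\<^sup>/\<^sup>n\<close> one supersolution has to be produced. It is found as
  \<open>u = exp (- w)\<close> with \<open>w\<close> convex. If \<open>\<phi>\<close> touches \<open>u\<close> from below at \<open>x\<close>, then
  \<open>\<psi> = - ln \<phi>\<close> touches \<open>w\<close> from above; with \<open>\<xi> = \<nabla>\<psi>(x)\<close>, \<open>M = D\<^sup>2\<psi>(x)\<close> and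
  \<open>A = (1/p) (I + (p - 2) e e\<^sup>T)\<close>, where \<open>e\<close> is the unit vector along \<open>\<xi>\<close> (or an eigenvector of
  the Hessian if \<open>\<xi> = 0\<close>), the inequality to be shown for \<open>\<phi>\<close> reads
  \<open>tr (A M) \<ge> l + (p - 1)/p \<bar>\<xi>\<bar>\<^sup>2\<close>. Convexity of \<open>w\<close> makes \<open>M\<close> positive semidefinite, and the
  inequality of arithmetic and geometric means for the eigenvalues of
  \<open>A\<^sup>1\<^sup>/\<^sup>2 M A\<^sup>1\<^sup>/\<^sup>2\<close>, together with \<open>det A = (p - 1)/p\<^sup>n\<close>, reduces this to the
  Monge-Ampere inequality
  \<open>g\<^sub>0(\<xi>) det M \<ge> 1\<close> for \<open>g\<^sub>0(\<xi>) = n\<^sup>n (p - 1)/p\<^sup>n (l + (p - 1)/p \<bar>\<xi>\<bar>\<^sup>2)\<^sup>-\<^sup>n\<close>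
  (\<open>det_le_anisotropic_trace_power\<close>, \<open>minimizer_contact_inequality\<close>).

  Thus the Aleksandrov-Bakelman-Pucci estimate is run backwards: \<open>g\<^sub>0(\<nabla>w) det D\<^sup>2w = 1\<close> says that
  \<open>\<nabla>w\<close> transports Lebesgue measure on \<open>\<Omega>\<close> to the measure with density \<open>g\<^sub>0\<close>. This can be achieved
  with room to spare as soon as the total mass of \<open>g\<^sub>0\<close> exceeds \<open>\<bar>\<Omega>\<bar>\<close>, and the mass, computed in
  \<open>nn_integral_inverse_quadratic_power\<close>, exceeds \<open>\<bar>\<Omega>\<bar>\<close> for \<open>l\<close> below the bound
  (\<open>K_const_powr_le\<close>; this is where \<open>min (p - 1) 1 ^ n \<le> p - 1\<close> enters).

  The Monge-Ampere equation itself is never solved. One restricts \<open>g\<^sub>0\<close> to a ball \<open>C\<close> that carries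
  more mass than \<open>\<bar>\<Omega>\<bar>\<close>, scales it down to a density \<open>g\<close> of mass exactly \<open>\<bar>\<Omega>\<bar>\<close>, and minimises the
  Kantorovich dual functional \<open>J(w) = \<integral>\<^sub>\<Omega> w + \<integral>\<^sub>C w\<^sup>* g\<close>. Replacing \<open>w\<close> by its biconjugate does
  not increase \<open>J\<close> and makes \<open>w\<close> convex and uniformly Lipschitz, so that a minimiser exists by the
  Arzela-Ascoli theorem (\<open>kantorovich_dual_minimizer\<close>). If \<open>g(\<nabla>\<psi>) \<bar>det D\<^sup>2\<psi>\<bar> < 1\<close> held at a point
  where \<open>\<psi>\<close> touches the minimiser from above, then lowering \<open>w\<close> there by a small bump \<open>\<rho>\<close>, down to a
  translate of a slightly more convex copy of \<open>\<psi>\<close>, would decrease the first integral by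
  \<open>\<integral>\<rho>\<close> and, after the change of variables \<open>\<xi> = \<nabla>\<psi>(y)\<close>, increase the second by at most
  \<open>\<integral>\<rho> g(\<nabla>\<psi>) \<bar>det D\<^sup>2\<psi>\<bar> < \<integral>\<rho>\<close>; this contradicts minimality (\<open>transport_competitor\<close>,
  \<open>minimizer_touching_jacobian\<close>).
\<close>

section \<open>Symmetric matrices: spectral theorem and determinant inequalities\<close>

lemma transpose_inner_swap:
  fixes A :: "real^'n^'m"
  shows "x \<bullet> (A *v y) = (transpose A *v x) \<bullet> y"
  by (simp add: dot_lmul_matrix flip: vector_transpose_matrix)

lemma symmetric_matrix_inner_commute:
  fixes A :: "real^'n^'n"
  assumes "transpose A = A"
  shows "x \<bullet> (A *v y) = y \<bullet> (A *v x)"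
  by (metis assms inner_commute transpose_inner_swap)

text \<open>
  A maximiser \<open>v\<close> of the Rayleigh quotient on the unit sphere of \<open>S\<close> is an eigenvector: moving
  from \<open>v\<close> in the direction of the residual \<open>A v - m v\<close> would otherwise increase the quotient.
\<close>

lemma symmetric_matrix_eigenvector_in_subspace:
  fixes A :: "real^'n::finite^'n"
  assumes sym: "transpose A = A" and S: "subspace S"
    and inv: "\<And>x. x \<in> S \<Longrightarrow> A *v x \<in> S" and nz: "S \<noteq> {0}"
  obtains v c where "v \<in> S" "norm v = 1" "A *v v = c *\<^sub>R v"
proof -
  define K where "K = S \<inter> sphere 0 1"
  have "compact K"
    unfolding K_def by (intro closed_Int_compact closed_subspace S compact_sphere)
  obtain x where x: "x \<in> S" "x \<noteq> 0"
    using nz S subspace_0 by blast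
  have "(1 / norm x) *\<^sub>R x \<in> K"
    using x S by (simp add: K_def subspace_scale)
  then have "K \<noteq> {}" by blast
  moreover have "continuous_on K (\<lambda>x. x \<bullet> (A *v x))"
    by (intro continuous_intros matrix_vector_mult_linear_continuous_on)
  ultimately obtain v where v: "v \<in> K" and vmax: "\<And>y. y \<in> K \<Longrightarrow> y \<bullet> (A *v y) \<le> v \<bullet> (A *v v)"
    using continuous_attains_sup[OF \<open>compact K\<close>, of "\<lambda>x. x \<bullet> (A *v x)"] by blast
  define m where "m = v \<bullet> (A *v v)"
  have vS: "v \<in> S" and v1: "norm v = 1" using v by (auto simp: K_def)
  have max: "y \<bullet> (A *v y) \<le> m * (y \<bullet> y)" if "y \<in> S" for y
  proof (cases "y = 0")
    case False
    then have "(1 / norm y) *\<^sub>R y \<in> K"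
      using that S by (simp add: K_def subspace_scale)
    from vmax[OF this] False show ?thesis
      by (simp add: matrix_vector_mult_scaleR m_def field_simps power2_eq_square flip: power2_norm_eq_inner)
  qed simp
  define z where "z = A *v v - m *\<^sub>R v"
  have zS: "z \<in> S" unfolding z_def by (intro subspace_diff S inv vS subspace_scale)
  define C where "C = m * (z \<bullet> z) - z \<bullet> (A *v z)"
  have ineq: "2 * t * (z \<bullet> z) \<le> t\<^sup>2 * C" for t
  proof -
    have "v + t *\<^sub>R z \<in> S" by (intro subspace_add S vS subspace_scale zS)
    from max[OF this]
    have "m + 2 * t * (z \<bullet> (A *v v)) + t\<^sup>2 * (z \<bullet> (A *v z)) \<le> m * (1 + 2 * t * (z \<bullet> v) + t\<^sup>2 * (z \<bullet> z))"
      using v1 symmetric_matrix_inner_commute[OF sym, of v z]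
      by (simp add: matrix_vector_mult_scaleR matrix_vector_right_distrib inner_add_left inner_add_right
          m_def power2_eq_square inner_commute algebra_simps norm_eq_1)
    then show ?thesis
      unfolding C_def z_def by (simp add: inner_diff_right algebra_simps)
  qed
  have "z = 0"
  proof (rule ccontr)
    assume "z \<noteq> 0"
    then have pos: "z \<bullet> z > 0" by simp
    \<comment> \<open>small enough for the quadratic term to lose against the linear one\<close>
    define t where "t = (z \<bullet> z) / (\<bar>C\<bar> + 1)"
    have t: "t > 0" using pos by (simp add: t_def)
    have "2 * (z \<bullet> z) \<le> t * C" using ineq[of t] t by (simp add: power2_eq_square)
    also have "t * C \<le> t * (\<bar>C\<bar> + 1)" using t by (intro mult_left_mono) auto
    also have "\<dots> = z \<bullet> z" by (simp add: t_def)
    finally show False using pos by simp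
  qed
  then show ?thesis using that[OF vS v1, of m] by (simp add: z_def)
qed

text \<open>
  Induction on the dimension: the orthogonal complement of an eigenvector within \<open>S\<close> is again
  invariant, by symmetry.
\<close>

lemma symmetric_matrix_eigenbasis_of_subspace:
  fixes A :: "real^'n::finite^'n"
  assumes sym: "transpose A = A" and S: "subspace S"
    and inv: "\<And>x. x \<in> S \<Longrightarrow> A *v x \<in> S"
  shows "\<exists>B. B \<subseteq> S \<and> pairwise orthogonal B \<and> (\<forall>b\<in>B. norm b = 1) \<and> span B = S
           \<and> (\<forall>b\<in>B. \<exists>c. A *v b = c *\<^sub>R b)"
  using S inv
proof (induction "dim S" arbitrary: S rule: less_induct)
  case less
  show ?case
  proof (cases "S = {0}")
    case True
    then show ?thesis by (intro exI[of _ "{}"]) auto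
  next
    case False
    then obtain v c where v: "v \<in> S" "norm v = 1" "A *v v = c *\<^sub>R v"
      using symmetric_matrix_eigenvector_in_subspace[OF sym less.prems] by blast
    define T where "T = S \<inter> {y. orthogonal v y}"
    have T: "subspace T" unfolding T_def
      using subspace_inter[OF less.prems(1) subspace_orthogonal_to_vector] .
    have "v \<notin> T" using v by (auto simp: T_def orthogonal_def)
    then have "T \<subset> S" using v by (auto simp: T_def)
    then have "dim T < dim S"
      by (metis T dim_psubset less.prems(1) span_eq_iff)
    moreover have "A *v x \<in> T" if "x \<in> T" for x
    proof -
      have "v \<bullet> (A *v x) = x \<bullet> (A *v v)" by (rule symmetric_matrix_inner_commute[OF sym])
      also have "\<dots> = 0" using that v by (simp add: T_def orthogonal_def inner_commute)
      finally show ?thesis using that less.prems(2) by (simp add: T_def orthogonal_def)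
    qed
    ultimately obtain B where B: "B \<subseteq> T" "pairwise orthogonal B" "\<forall>b\<in>B. norm b = 1" "span B = T"
       "\<forall>b\<in>B. \<exists>c. A *v b = c *\<^sub>R b"
      using less.hyps[OF _ T] by blast
    have "span (insert v B) = S"
    proof
      show "span (insert v B) \<subseteq> S"
        using B \<open>T \<subset> S\<close> v by (intro span_minimal less.prems) auto
      show "S \<subseteq> span (insert v B)"
      proof
        fix x assume x: "x \<in> S"
        have "x - (v \<bullet> x) *\<^sub>R v \<in> T"
          using x v less.prems(1)
          by (simp add: T_def subspace_diff subspace_scale orthogonal_def inner_diff_right norm_eq_1)
        then show "x \<in> span (insert v B)"
          using B(4) span_breakdown_eq by blast
      qed
    qed
    moreover have "pairwise orthogonal (insert v B)"
      using B by (auto simp: pairwise_insert T_def orthogonal_commute)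
    ultimately show ?thesis
      using B v \<open>T \<subset> S\<close> by (intro exI[of _ "insert v B"]) auto
  qed
qed

proposition symmetric_matrix_orthonormal_eigenbasis:
  fixes A :: "real^'n::finite^'n"
  assumes sym: "transpose A = A"
  obtains Q :: "real^'n^'n" and d :: "'n \<Rightarrow> real"
  where "orthogonal_matrix Q" "\<And>i. A *v column i Q = d i *\<^sub>R column i Q"
proof -
  obtain B where B: "pairwise orthogonal B" "\<forall>b\<in>B. norm b = 1" "span B = UNIV"
       "\<forall>b\<in>B. \<exists>c. A *v b = c *\<^sub>R b"
    using symmetric_matrix_eigenbasis_of_subspace[OF sym, of UNIV] by auto
  have ind: "independent B"
    using B by (intro pairwise_orthogonal_independent) auto
  then have fin: "finite B" and "card B = CARD('n)"
    using B(3) indep_card_eq_dim_span[OF ind] by (auto simp: independent_imp_finite)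
  then obtain \<beta> where \<beta>: "bij_betw \<beta> (UNIV :: 'n set) B"
    by (metis bij_betw_iff_card finite_class.finite_UNIV)
  have \<beta>B: "\<beta> i \<in> B" for i using \<beta> by (auto simp: bij_betw_def)
  obtain c where c: "\<And>b. b \<in> B \<Longrightarrow> A *v b = c b *\<^sub>R b" using B(4) by metis
  define Q :: "real^'n^'n" where "Q = (\<chi> i j. \<beta> j $ i)"
  have col: "column j Q = \<beta> j" for j by (simp add: Q_def column_def)
  have "orthogonal_matrix Q"
    unfolding orthogonal_matrix_orthonormal_columns col
    using B(1,2) \<beta>B bij_betw_imp_inj_on[OF \<beta>] unfolding pairwise_def inj_on_def by (metis UNIV_I)
  then show ?thesis using that[of Q "\<lambda>i. c (\<beta> i)"] c \<beta>B col by auto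
qed

lemma orthogonal_columns_inner:
  assumes "orthogonal_matrix (Q :: real^'n::finite^'n)"
  shows "column i Q \<bullet> column j Q = (if i = j then 1 else 0)"
  using assms by (auto simp: orthogonal_matrix_orthonormal_columns norm_eq_1 orthogonal_def)

lemma diagonalized_matrix_det_trace:
  fixes A Q :: "real^'n::finite^'n"
  assumes Q: "orthogonal_matrix Q" and eig: "\<And>i. A *v column i Q = d i *\<^sub>R column i Q"
  shows "det A = (\<Prod>i\<in>UNIV. d i)" "trace A = (\<Sum>i\<in>UNIV. d i)"
proof -
  define D :: "real^'n^'n" where "D = transpose Q ** A ** Q"
  have D: "D $ i $ j = (if i = j then d i else 0)" for i j
  proof -
    have "D $ i $ j = column i Q \<bullet> (A *v column j Q)"
      unfolding D_def matrix_mul_assoc [symmetric]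
      by (simp add: matrix_matrix_mult_def transpose_def column_def inner_vec_def matrix_vector_mult_def)
    then show ?thesis using orthogonal_columns_inner[OF Q] by (simp add: eig)
  qed
  have QQ: "Q ** transpose Q = mat 1" using Q by (simp add: orthogonal_matrix_def)
  then have dQ: "det Q * det Q = 1"
    by (metis det_I det_mul det_transpose)
  have "det D = det A"
    unfolding D_def det_mul det_transpose using dQ by (simp add: mult.assoc mult.left_commute)
  moreover have "det D = (\<Prod>i\<in>UNIV. d i)"
    using det_diagonal[of D] D by simp
  ultimately show "det A = (\<Prod>i\<in>UNIV. d i)" by simp
  have "trace D = trace (Q ** (transpose Q ** A))"
    unfolding D_def by (rule trace_mul_sym)
  also have "\<dots> = trace A" by (simp add: matrix_mul_assoc QQ)
  finally show "trace A = (\<Sum>i\<in>UNIV. d i)" by (simp add: trace_def D)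
qed

text \<open>
  The inequality of arithmetic and geometric means for the eigenvalues.
\<close>

lemma det_le_trace_power_psd:
  fixes A :: "real^'n::finite^'n"
  assumes sym: "transpose A = A" and psd: "\<And>x. x \<bullet> (A *v x) \<ge> 0"
  shows "0 \<le> det A" "det A \<le> (trace A / CARD('n)) ^ CARD('n)" "0 \<le> trace A"
proof -
  obtain Q d where Q: "orthogonal_matrix Q" and d: "\<And>i. A *v column i Q = d i *\<^sub>R column i Q"
    using symmetric_matrix_orthonormal_eigenbasis[OF sym] by blast
  note dt = diagonalized_matrix_det_trace[OF Q d]
  have nn: "d i \<ge> 0" for i
    using psd[of "column i Q"] orthogonal_columns_inner[OF Q, of i i] by (simp add: d)
  show "0 \<le> det A" "0 \<le> trace A" using nn by (simp_all add: dt prod_nonneg sum_nonneg)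
  let ?n = "CARD('n)"
  have "(\<Prod>i\<in>UNIV. d i) = ((\<Prod>i\<in>UNIV. d i) powr (1 / ?n)) ^ ?n"
    using prod_nonneg[of UNIV d] nn by (simp add: powr_realpow' [symmetric] powr_powr)
  also have "\<dots> \<le> (\<Sum>i\<in>UNIV. d i / ?n) ^ ?n"
    using arith_geom_mean[of "UNIV :: 'n set" d] nn by (intro power_mono) auto
  also have "\<dots> = (trace A / ?n) ^ ?n" by (simp add: dt sum_divide_distrib)
  finally show "det A \<le> (trace A / CARD('n)) ^ CARD('n)" by (simp add: dt)
qed

text \<open>
  This makes \<open>Max\<close> and \<open>Min\<close> of the spectrum genuine eigenvalues.
\<close>

lemma real_eigenvalues_symmetric:
  fixes A :: "real^'n::finite^'n"
  assumes sym: "transpose A = A"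
  shows "finite (real_eigenvalues A)" "real_eigenvalues A \<noteq> {}"
proof -
  obtain Q d where Q: "orthogonal_matrix Q" and d: "\<And>i. A *v column i Q = d i *\<^sub>R column i Q"
    using symmetric_matrix_orthonormal_eigenbasis[OF sym] by blast
  have nz: "column i Q \<noteq> 0" for i
    using orthogonal_columns_inner[OF Q, of i i] by auto
  then show "real_eigenvalues A \<noteq> {}" using d by (auto simp: real_eigenvalues_def)
  have "real_eigenvalues A \<subseteq> range d"
  proof
    fix l assume "l \<in> real_eigenvalues A"
    then obtain v where v: "v \<noteq> 0" "A *v v = l *\<^sub>R v" by (auto simp: real_eigenvalues_def)
    have "Q ** transpose Q = mat 1" using Q by (simp add: orthogonal_matrix_def)
    then have "Q *v (transpose Q *v v) = v" by (metis matrix_vector_mul_assoc matrix_vector_mul_lid)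
    then have "transpose Q *v v \<noteq> 0" using v by auto
    then obtain i where i: "(transpose Q *v v) $ i \<noteq> 0" by (auto simp: vec_eq_iff)
    then have "column i Q \<bullet> v \<noteq> 0"
      by (simp add: matrix_vector_mult_def transpose_def column_def inner_vec_def)
    moreover have "column i Q \<bullet> (A *v v) = v \<bullet> (A *v column i Q)"
      by (rule symmetric_matrix_inner_commute[OF sym])
    ultimately have "l = d i" by (simp add: v d inner_commute)
    then show "l \<in> range d" by simp
  qed
  then show "finite (real_eigenvalues A)" by (rule finite_subset) simp
qed

definition outer_square :: "real^'n \<Rightarrow> real^'n^'n" where
  "outer_square e = (\<chi> i j. e $ i * e $ j)"

lemma outer_square_mult_vec: "outer_square e *v x = (e \<bullet> x) *\<^sub>R (e :: real^'n::finite)"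
  by (simp add: vec_eq_iff outer_square_def matrix_vector_mult_def inner_vec_def sum_distrib_left
      mult_ac)

text \<open>
  In an orthonormal basis that contains \<open>e\<close> the matrix is diagonal with entries \<open>1 + c, 1, \<dots>, 1\<close>.
\<close>

lemma det_mat1_plus_outer_square:
  fixes e :: "real^'n::finite"
  assumes "norm e = 1"
  shows "det (mat 1 + c *\<^sub>R outer_square e) = 1 + c"
proof -
  fix k :: 'n
  obtain Q where Q: "orthogonal_matrix Q" and Qe: "Q *v axis k 1 = e"
    using orthogonal_matrix_exists_basis[OF assms] by blast
  define S where "S = mat 1 + c *\<^sub>R outer_square e"
  have S: "S *v x = x + c *\<^sub>R ((e \<bullet> x) *\<^sub>R e)" for x
    by (simp add: S_def matrix_vector_mult_add_rdistrib scaleR_matrix_vector_assoc [symmetric] outer_square_mult_vec)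
  have col: "column k Q = e" using Qe by (simp add: matrix_vector_mult_basis)
  have "S *v column i Q = (if i = k then 1 + c else 1) *\<^sub>R column i Q" for i
    using orthogonal_columns_inner[OF Q, of k i] col by (auto simp: S algebra_simps)
  from diagonalized_matrix_det_trace(1)[OF Q this]
  show ?thesis by (simp add: S_def)
qed

text \<open>
  With \<open>P = I + (a - 1) e e\<^sup>T\<close>, the quantity on the right is the trace of \<open>P A\<close> and \<open>det P = a\<close>.
  The square root of \<open>P\<close> is explicit, \<open>S = I + (sqrt a - 1) e e\<^sup>T\<close>, so that the isotropic inequality
  can be applied to the positive semidefinite matrix \<open>S A S\<close>.
\<close>

lemma det_le_anisotropic_trace_power:
  fixes A :: "real^'n::finite^'n"
  assumes sym: "transpose A = A" and psd: "\<And>x. x \<bullet> (A *v x) \<ge> 0"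
    and e: "norm e = 1" and a: "0 < a"
  shows "0 \<le> trace A + (a - 1) * (e \<bullet> (A *v e))"
    and "a * det A \<le> ((trace A + (a - 1) * (e \<bullet> (A *v e))) / CARD('n)) ^ CARD('n)"
proof -
  define c where "c = sqrt a - 1"
  define S where "S = mat 1 + c *\<^sub>R outer_square e"
  have S: "S *v x = x + c *\<^sub>R ((e \<bullet> x) *\<^sub>R e)" for x
    by (simp add: S_def matrix_vector_mult_add_rdistrib scaleR_matrix_vector_assoc [symmetric] outer_square_mult_vec)
  have tS: "transpose S = S"
    by (simp add: S_def vec_eq_iff transpose_def outer_square_def mat_def mult.commute)
  have c2: "2 * c + c\<^sup>2 = a - 1" using a by (simp add: c_def power2_eq_square algebra_simps)
  have SS: "S ** S = mat 1 + (a - 1) *\<^sub>R outer_square e"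
  proof -
    have "(S ** S) *v x = (mat 1 + (a - 1) *\<^sub>R outer_square e) *v x" for x
      using e by (simp add: matrix_vector_mul_assoc [symmetric] S matrix_vector_mult_add_rdistrib
        scaleR_matrix_vector_assoc [symmetric] outer_square_mult_vec inner_add_right norm_eq_1
        c2[symmetric] scaleR_add_left [symmetric] add.assoc power2_eq_square del: scaleR_add_left)
         (simp add: algebra_simps)
    then show ?thesis by (simp add: matrix_eq)
  qed
  define B where "B = S ** A ** S"
  have symB: "transpose B = B" by (simp add: B_def matrix_transpose_mul tS sym matrix_mul_assoc)
  have psdB: "x \<bullet> (B *v x) \<ge> 0" for x
  proof -
    have "x \<bullet> (B *v x) = (S *v x) \<bullet> (A *v (S *v x))"
      by (simp add: B_def matrix_vector_mul_assoc [symmetric] transpose_inner_swap[of x S] tS)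
    then show ?thesis using psd by simp
  qed
  have "det S = sqrt a" using det_mat1_plus_outer_square[OF e, of c] by (simp add: S_def c_def)
  then have dB: "det B = a * det A"
    using a by (simp add: B_def det_mul mult.commute mult.left_commute flip: mult.assoc)
  have "trace B = trace (S ** (S ** A))" unfolding B_def by (rule trace_mul_sym)
  also have "\<dots> = trace (A + (a - 1) *\<^sub>R (outer_square e ** A))"
    by (simp add: matrix_mul_assoc SS)
      (simp add: vec_eq_iff trace_def matrix_matrix_mult_def distrib_right sum.distrib sum_distrib_left mat_def
        if_distrib[of "\<lambda>x. x * _"] mult.assoc cong: if_cong)
  also have "\<dots> = trace A + (a - 1) * trace (outer_square e ** A)"
    by (simp add: trace_def sum.distrib sum_distrib_left)
  also have "trace (outer_square e ** A) = e \<bullet> (A *v e)"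
    unfolding trace_def matrix_matrix_mult_def outer_square_def inner_vec_def matrix_vector_mult_def
    by (simp add: sum_distrib_left) (subst sum.swap, simp add: mult_ac)
  finally have tB: "trace B = trace A + (a - 1) * (e \<bullet> (A *v e))" .
  show "0 \<le> trace A + (a - 1) * (e \<bullet> (A *v e))"
    and "a * det A \<le> ((trace A + (a - 1) * (e \<bullet> (A *v e))) / CARD('n)) ^ CARD('n)"
    using det_le_trace_power_psd[OF symB psdB] by (simp_all add: dB tB)
qed

section \<open>Second derivatives\<close>

text \<open>
  The mean value theorem along \<open>u\<close> turns the second difference into a difference of gradients at
  distance of order \<open>t\<close> from \<open>x\<close>, to which differentiability of the gradient at \<open>x\<close> applies.
\<close>

lemma second_difference_quotient:
  fixes f :: "real^'n::finite \<Rightarrow> real" and M :: "real^'n^'n"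
  assumes r: "0 < r"
    and df: "\<And>y. y \<in> ball x r \<Longrightarrow> (f has_derivative (\<lambda>h. G y \<bullet> h)) (at y)"
    and dG: "(G has_derivative (\<lambda>h. M *v h)) (at x)"
    and e: "0 < e"
  shows "\<exists>d>0. \<forall>t. 0 < t \<and> t < d \<longrightarrow>
    \<bar>f (x + t *\<^sub>R u + t *\<^sub>R v) - f (x + t *\<^sub>R u) - f (x + t *\<^sub>R v) + f x - t\<^sup>2 * (u \<bullet> (M *v v))\<bar> \<le> e * t\<^sup>2"
proof -
  define N where "N = norm u + norm v + 1"
  have N: "N > 0" by (simp add: N_def add_nonneg_pos)
  \<comment> \<open>two gradient errors, each at most \<open>e' t N\<close>, are paired with a vector of norm at most \<open>N\<close>\<close>
  define e' where "e' = e / (2 * N * N)"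
  have e': "e' > 0" using e N by (simp add: e'_def)
  obtain \<delta> where \<delta>: "\<delta> > 0" "\<And>y. norm (y - x) < \<delta> \<Longrightarrow> norm (G y - G x - M *v (y - x)) \<le> e' * norm (y - x)"
    using dG e' unfolding has_derivative_at_alt by blast
  define d where "d = min \<delta> r / N"
  have "d > 0" using \<delta> r N by (simp add: d_def)
  moreover have "\<bar>f (x + t *\<^sub>R u + t *\<^sub>R v) - f (x + t *\<^sub>R u) - f (x + t *\<^sub>R v) + f x - t\<^sup>2 * (u \<bullet> (M *v v))\<bar> \<le> e * t\<^sup>2"
    if t: "0 < t" "t < d" for t
  proof -
    have tN: "t * N < \<delta>" "t * N < r" using t N by (auto simp: d_def field_simps)
    have small: "norm (s *\<^sub>R u + c *\<^sub>R v) \<le> t * N" if "0 \<le> s" "s \<le> t" "0 \<le> c" "c \<le> t" for s c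
    proof -
      have "norm (s *\<^sub>R u + c *\<^sub>R v) \<le> s * norm u + c * norm v"
        using norm_triangle_ineq[of "s *\<^sub>R u" "c *\<^sub>R v"] that by simp
      also have "\<dots> \<le> t * norm u + t * norm v" using that by (intro add_mono mult_right_mono) auto
      also have "\<dots> \<le> t * N" using t by (simp add: N_def algebra_simps)
      finally show ?thesis .
    qed
    have inb: "x + s *\<^sub>R u + c *\<^sub>R v \<in> ball x r" if "0 \<le> s" "s \<le> t" "0 \<le> c" "c \<le> t" for s c
      using small[OF that] tN norm_minus_cancel[of "s *\<^sub>R u + c *\<^sub>R v"] by (simp add: dist_norm add.assoc)
    define k where "k s = f (x + s *\<^sub>R u + t *\<^sub>R v) - f (x + s *\<^sub>R u)" for s
    have dk: "(k has_real_derivative (G (x + s *\<^sub>R u + t *\<^sub>R v) - G (x + s *\<^sub>R u)) \<bullet> u) (at s)"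
      if s: "0 \<le> s" "s \<le> t" for s
    proof -
      have 1: "((\<lambda>s. f (x + s *\<^sub>R u + t *\<^sub>R v)) has_derivative (\<lambda>h. G (x + s *\<^sub>R u + t *\<^sub>R v) \<bullet> (h *\<^sub>R u))) (at s)"
        by (rule has_derivative_compose[where f = "\<lambda>s. x + s *\<^sub>R u + t *\<^sub>R v", OF _ df])
           (use inb[of s t] s t in \<open>auto intro!: derivative_eq_intros\<close>)
      have 2: "((\<lambda>s. f (x + s *\<^sub>R u)) has_derivative (\<lambda>h. G (x + s *\<^sub>R u) \<bullet> (h *\<^sub>R u))) (at s)"
        by (rule has_derivative_compose[where f = "\<lambda>s. x + s *\<^sub>R u", OF _ df])
           (use inb[of s 0] s t in \<open>auto intro!: derivative_eq_intros\<close>)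
      show ?thesis
        unfolding k_def has_field_derivative_def
        by (rule has_derivative_eq_rhs[OF has_derivative_diff[OF 1 2]]) (simp add: fun_eq_iff inner_diff_left algebra_simps)
    qed
    obtain s where s: "0 < s" "s < t"
      and ks: "k t - k 0 = (t - 0) * ((G (x + s *\<^sub>R u + t *\<^sub>R v) - G (x + s *\<^sub>R u)) \<bullet> u)"
      using MVT2[of 0 t k, OF t(1) dk] by auto
    define y1 where "y1 = x + s *\<^sub>R u + t *\<^sub>R v"
    define y2 where "y2 = x + s *\<^sub>R u"
    have b1: "norm (y1 - x) \<le> t * N" using small[of s t] s t by (simp add: y1_def add.assoc)
    have b2: "norm (y2 - x) \<le> t * N" using small[of s 0] s t by (simp add: y2_def)
    have e1: "norm (G y1 - G x - M *v (y1 - x)) \<le> e' * (t * N)"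
      using \<delta>(2)[of y1] b1 tN e' by (meson le_less_trans mult_left_mono order_trans less_imp_le)
    have e2: "norm (G y2 - G x - M *v (y2 - x)) \<le> e' * (t * N)"
      using \<delta>(2)[of y2] b2 tN e' by (meson le_less_trans mult_left_mono order_trans less_imp_le)
    have "G y1 - G y2 - t *\<^sub>R (M *v v) = (G y1 - G x - M *v (y1 - x)) - (G y2 - G x - M *v (y2 - x))"
      by (simp add: y1_def y2_def algebra_simps)
    then have "norm (G y1 - G y2 - t *\<^sub>R (M *v v)) \<le> e' * (t * N) + e' * (t * N)"
      using e1 e2 norm_triangle_ineq4 by (smt (verit))
    then have *: "norm (G y1 - G y2 - t *\<^sub>R (M *v v)) * norm u \<le> (2 * e' * (t * N)) * N"
      using N e' t by (intro mult_mono) (auto simp: N_def)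
    have "k t - k 0 - t\<^sup>2 * (u \<bullet> (M *v v)) = t * ((G y1 - G y2 - t *\<^sub>R (M *v v)) \<bullet> u)"
      unfolding ks y1_def y2_def by (simp add: algebra_simps power2_eq_square inner_commute inner_diff_left)
    then have "\<bar>k t - k 0 - t\<^sup>2 * (u \<bullet> (M *v v))\<bar> = t * \<bar>(G y1 - G y2 - t *\<^sub>R (M *v v)) \<bullet> u\<bar>"
      using t by (simp add: abs_mult)
    also have "\<dots> \<le> t * ((2 * e' * (t * N)) * N)"
      using t * Cauchy_Schwarz_ineq2 order_trans by (intro mult_left_mono) (blast, simp)
    also have "\<dots> = e * t\<^sup>2" using N by (simp add: e'_def power2_eq_square)
    finally show ?thesis by (simp add: k_def algebra_simps)
  qed
  ultimately show ?thesis by blast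
qed

text \<open>
  The second difference is symmetric in the two directions.
\<close>

proposition second_derivative_symmetric:
  fixes f :: "real^'n::finite \<Rightarrow> real" and M :: "real^'n^'n"
  assumes r: "0 < r"
    and df: "\<And>y. y \<in> ball x r \<Longrightarrow> (f has_derivative (\<lambda>h. G y \<bullet> h)) (at y)"
    and dG: "(G has_derivative (\<lambda>h. M *v h)) (at x)"
  shows "transpose M = M"
proof -
  have le: "\<bar>u \<bullet> (M *v v) - v \<bullet> (M *v u)\<bar> \<le> 2 * e" if e: "e > 0" for u v e
  proof -
    obtain d1 where d1: "d1 > 0" "\<And>t. 0 < t \<Longrightarrow> t < d1 \<Longrightarrow>
      \<bar>f (x + t *\<^sub>R u + t *\<^sub>R v) - f (x + t *\<^sub>R u) - f (x + t *\<^sub>R v) + f x - t\<^sup>2 * (u \<bullet> (M *v v))\<bar> \<le> e * t\<^sup>2"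
      using second_difference_quotient[OF r df dG e, where u=u and v=v] by blast
    obtain d2 where d2: "d2 > 0" "\<And>t. 0 < t \<Longrightarrow> t < d2 \<Longrightarrow>
      \<bar>f (x + t *\<^sub>R v + t *\<^sub>R u) - f (x + t *\<^sub>R v) - f (x + t *\<^sub>R u) + f x - t\<^sup>2 * (v \<bullet> (M *v u))\<bar> \<le> e * t\<^sup>2"
      using second_difference_quotient[OF r df dG e, where u=v and v=u] by blast
    define t where "t = min d1 d2 / 2"
    have t: "0 < t" "t < d1" "t < d2" using d1 d2 by (auto simp: t_def)
    have "x + t *\<^sub>R v + t *\<^sub>R u = x + t *\<^sub>R u + t *\<^sub>R v" by simp
    then have "\<bar>t\<^sup>2 * (u \<bullet> (M *v v)) - t\<^sup>2 * (v \<bullet> (M *v u))\<bar> \<le> 2 * (e * t\<^sup>2)"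
      using d1(2)[OF t(1,2)] d2(2)[OF t(1,3)] by (smt (verit))
    also have "\<bar>t\<^sup>2 * (u \<bullet> (M *v v)) - t\<^sup>2 * (v \<bullet> (M *v u))\<bar> = t\<^sup>2 * \<bar>u \<bullet> (M *v v) - v \<bullet> (M *v u)\<bar>"
      by (simp add: abs_mult flip: right_diff_distrib)
    finally show ?thesis using t by (simp add: field_simps)
  qed
  have "u \<bullet> (M *v v) = v \<bullet> (M *v u)" for u v
  proof (rule ccontr)
    assume "\<not> ?thesis"
    then show False using le[of "\<bar>u \<bullet> (M *v v) - v \<bullet> (M *v u)\<bar> / 4" u v] by auto
  qed
  from this[of "axis _ 1" "axis _ 1"] show ?thesis
    by (simp add: vec_eq_iff transpose_def matrix_vector_mult_basis inner_axis' column_def)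
qed

text \<open>
  An affine function below \<open>f\<close> that meets it at \<open>x\<close> makes the second differences
  \<open>f (x + t u) + f (x - t u) - 2 f x\<close> nonnegative.
\<close>

lemma hessian_psd_at_affine_support:
  fixes f :: "real^'n::finite \<Rightarrow> real" and M :: "real^'n^'n"
  assumes r: "0 < r"
    and df: "\<And>y. y \<in> ball x r \<Longrightarrow> (f has_derivative (\<lambda>h. G y \<bullet> h)) (at y)"
    and dG: "(G has_derivative (\<lambda>h. M *v h)) (at x)"
    and supp: "\<And>y. y \<in> ball x r \<Longrightarrow> f x + \<xi> \<bullet> (y - x) \<le> f y"
  shows "0 \<le> u \<bullet> (M *v u)"
proof (rule ccontr)
  assume neg: "\<not> ?thesis"
  define e where "e = - (u \<bullet> (M *v u)) / 2"
  have e: "e > 0" using neg by (simp add: e_def)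
  obtain d where d: "d > 0" "\<And>t. 0 < t \<Longrightarrow> t < d \<Longrightarrow>
      \<bar>f (x + t *\<^sub>R u + t *\<^sub>R (- u)) - f (x + t *\<^sub>R u) - f (x + t *\<^sub>R (- u)) + f x - t\<^sup>2 * (u \<bullet> (M *v (- u)))\<bar> \<le> e * t\<^sup>2"
    using second_difference_quotient[OF r df dG e, where u=u and v="-u"] by blast
  have "u \<noteq> 0" using neg by auto
  define t where "t = min (d / 2) (r / (2 * norm u))"
  have t: "0 < t" "t < d" using d r \<open>u \<noteq> 0\<close> by (auto simp: t_def)
  have "t * norm u \<le> r / 2" using \<open>u \<noteq> 0\<close> r by (simp add: t_def min_def field_simps)
  then have b: "x + t *\<^sub>R u \<in> ball x r" "x - t *\<^sub>R u \<in> ball x r"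
    using r t by (auto simp: dist_norm)
  have "2 * f x \<le> f (x + t *\<^sub>R u) + f (x - t *\<^sub>R u)"
    using supp[OF b(1)] supp[OF b(2)] by simp
  moreover have "u \<bullet> (M *v (- u)) = 2 * e"
    using matrix_vector_mult_scaleR[of M "-1" u] by (simp add: e_def)
  moreover have "\<bar>f (x + t *\<^sub>R u + t *\<^sub>R (- u)) - f (x + t *\<^sub>R u) - f (x + t *\<^sub>R (- u)) + f x - 2 * (e * t\<^sup>2)\<bar> \<le> e * t\<^sup>2"
    using d(2)[OF t] calculation(2) by (simp add: mult_ac)
  ultimately have "2 * (e * t\<^sup>2) \<le> e * t\<^sup>2" by simp
  then show False using e t by simp
qed

lemma has_derivative_grad:
  assumes "f differentiable (at x)"
  shows "(f has_derivative (\<lambda>h. grad f x \<bullet> h)) (at (x :: real^'n::finite))"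
proof -
  have D: "(f has_derivative frechet_derivative f (at x)) (at x)"
    using assms frechet_derivative_works by blast
  then interpret bounded_linear "frechet_derivative f (at x)" by (rule has_derivative_bounded_linear)
  have "frechet_derivative f (at x) h = grad f x \<bullet> h" for h
  proof -
    have "h = (\<Sum>i\<in>UNIV. h $ i *\<^sub>R axis i 1)"
      by (simp add: basis_expansion flip: scalar_mult_eq_scaleR)
    then have "frechet_derivative f (at x) h = frechet_derivative f (at x) (\<Sum>i\<in>UNIV. h $ i *\<^sub>R axis i 1)"
      by (rule arg_cong)
    also have "\<dots> = (\<Sum>i\<in>UNIV. h $ i * frechet_derivative f (at x) (axis i 1))"
      by (simp only: sum scaleR real_scaleR_def)
    finally show ?thesis by (simp add: grad_def partial_deriv_def inner_vec_def mult.commute)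
  qed
  then have "frechet_derivative f (at x) = (\<lambda>h. grad f x \<bullet> h)" by blast
  with D show ?thesis by simp
qed

text \<open>
  The entries of the Hessian are partial derivatives \<open>\<partial>\<^sub>i \<partial>\<^sub>j f\<close> with the inner derivative in the column
  index, so the derivative of the gradient is a priori the transposed Hessian; symmetry removes the
  transposition.
\<close>

lemma smooth_on_derivatives:
  fixes f :: "real^'n::finite \<Rightarrow> real"
  assumes f: "smooth_on S f" and S: "open S" and x: "x \<in> S"
  shows "(f has_derivative (\<lambda>h. grad f x \<bullet> h)) (at x)"
    and "(grad f has_derivative (\<lambda>h. hessian f x *v h)) (at x)"
    and "transpose (hessian f x) = hessian f x"
proof -
  have d1: "f differentiable (at y)" if "y \<in> S" for y
    using f that unfolding smooth_on_def by (metis C_k_on.simps(2))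
  have d2: "partial_deriv i f differentiable (at y)" if "y \<in> S" for y i
    using f that unfolding smooth_on_def by (metis C_k_on.simps(2))
  show 1: "(f has_derivative (\<lambda>h. grad f x \<bullet> h)) (at x)" using has_derivative_grad d1 x by blast
  have "(grad f has_derivative (\<lambda>h. \<chi> j. grad (partial_deriv j f) x \<bullet> h)) (at x)"
    unfolding grad_def[of f, abs_def]
    by (subst has_derivative_componentwise_within)
       (auto simp: Basis_vec_def inner_axis' inner_axis intro!: has_derivative_grad d2 x)
  moreover have "(\<lambda>h. \<chi> j. grad (partial_deriv j f) x \<bullet> h) = (\<lambda>h. transpose (hessian f x) *v h)"
    by (simp add: fun_eq_iff vec_eq_iff grad_def hessian_def transpose_def matrix_vector_mult_def inner_vec_def)
  ultimately have 2: "(grad f has_derivative (\<lambda>h. transpose (hessian f x) *v h)) (at x)" by simp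
  obtain r where r: "r > 0" "ball x r \<subseteq> S" using S x openE by blast
  have "transpose (transpose (hessian f x)) = transpose (hessian f x)"
    using second_derivative_symmetric[OF r(1) has_derivative_grad 2] d1 r by blast
  then show 3: "transpose (hessian f x) = hessian f x" by simp
  show "(grad f has_derivative (\<lambda>h. hessian f x *v h)) (at x)" using 2 3 by simp
qed

lemma continuous_on_hessian:
  fixes f :: "real^'n::finite \<Rightarrow> real"
  assumes "smooth_on S f"
  shows "continuous_on S (hessian f)"
proof -
  have "C_k_on (Suc (Suc 0)) S f" using assms unfolding smooth_on_def by blast
  then have "continuous_on S (partial_deriv i (partial_deriv j f))" for i j by simp
  then show ?thesis unfolding hessian_def[abs_def] by (intro continuous_intros)
qed

lemma derivatives_minus_ln:
  fixes f :: "real^'n::finite \<Rightarrow> real"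
  assumes f: "(f has_derivative (\<lambda>h. grad f x \<bullet> h)) (at x)"
    and g: "(grad f has_derivative (\<lambda>h. hessian f x *v h)) (at x)"
    and pos: "f x > 0"
  shows "((\<lambda>y. - ln (f y)) has_derivative (\<lambda>h. (- (1 / f x) *\<^sub>R grad f x) \<bullet> h)) (at x)"
    and "((\<lambda>y. - (1 / f y) *\<^sub>R grad f y) has_derivative
        (\<lambda>h. (outer_square ((1 / f x) *\<^sub>R grad f x) - (1 / f x) *\<^sub>R hessian f x) *v h)) (at x)"
proof -
  show "((\<lambda>y. - ln (f y)) has_derivative (\<lambda>h. (- (1 / f x) *\<^sub>R grad f x) \<bullet> h)) (at x)"
    by (rule has_derivative_eq_rhs[OF has_derivative_minus[OF has_derivative_ln[OF pos f]]])
       (simp add: fun_eq_iff divide_inverse mult.commute)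
  show "((\<lambda>y. - (1 / f y) *\<^sub>R grad f y) has_derivative
        (\<lambda>h. (outer_square ((1 / f x) *\<^sub>R grad f x) - (1 / f x) *\<^sub>R hessian f x) *v h)) (at x)"
    using pos
    by (auto intro!: derivative_eq_intros f g
       simp: fun_eq_iff matrix_vector_mult_diff_rdistrib outer_square_mult_vec
         scaleR_matrix_vector_assoc [symmetric] divide_inverse power2_eq_square mult_ac)
qed

section \<open>Change of variables for matrices indexed by a finite type\<close>

text \<open>
  A copy of a finite type that carries an arbitrary well-order. Relabelling the coordinates by this
  copy reduces the change of variables formula for an arbitrary finite index type to the formula for a
  well-ordered one.
\<close>

typedef 'a ordered_copy = "UNIV :: 'a set"
  morphisms of_copy to_copy by simp

lemma bij_of_copy: "bij (of_copy :: 'a ordered_copy \<Rightarrow> 'a)"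
proof (rule bijI)
  show "inj (of_copy :: 'a ordered_copy \<Rightarrow> 'a)" by (simp add: inj_def of_copy_inject)
  show "surj (of_copy :: 'a ordered_copy \<Rightarrow> 'a)" by (rule surjI[of _ to_copy]) (simp add: to_copy_inverse)
qed

instance ordered_copy :: (finite) finite
proof
  show "finite (UNIV :: 'a ordered_copy set)"
    using bij_betw_finite[OF bij_of_copy[where 'a = 'a]] by simp
qed

definition finite_code :: "'a::finite \<Rightarrow> nat" where
  "finite_code = (SOME f. inj f)"

lemma inj_finite_code: "inj (finite_code :: 'a::finite \<Rightarrow> nat)"
proof -
  have "\<exists>f :: 'a \<Rightarrow> nat. inj f"
    using finite_imp_inj_to_nat_seg[OF finite_class.finite_UNIV] by blast
  then show ?thesis unfolding finite_code_def by (rule someI_ex)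
qed

instantiation ordered_copy :: (finite) wellorder
begin

definition less_eq_ordered_copy :: "'a ordered_copy \<Rightarrow> 'a ordered_copy \<Rightarrow> bool" where
  "x \<le> y \<longleftrightarrow> finite_code (of_copy x) \<le> finite_code (of_copy y)"

definition less_ordered_copy :: "'a ordered_copy \<Rightarrow> 'a ordered_copy \<Rightarrow> bool" where
  "x < y \<longleftrightarrow> finite_code (of_copy x) < finite_code (of_copy y)"

instance
proof
  fix x y z :: "'a ordered_copy" and P
  show "x < y \<longleftrightarrow> x \<le> y \<and> \<not> y \<le> x" "x \<le> x" "x \<le> y \<or> y \<le> x"
    by (auto simp: less_eq_ordered_copy_def less_ordered_copy_def)
  show "x \<le> y \<Longrightarrow> y \<le> z \<Longrightarrow> x \<le> z" by (simp add: less_eq_ordered_copy_def)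
  show "x = y" if "x \<le> y" "y \<le> x"
  proof -
    have "finite_code (of_copy x) = finite_code (of_copy y)"
      using that unfolding less_eq_ordered_copy_def by (rule antisym)
    then have "of_copy x = of_copy y" by (rule injD[OF inj_finite_code])
    then show ?thesis by (rule iffD1[OF of_copy_inject])
  qed
  show "P x" if "\<And>x. (\<And>y. y < x \<Longrightarrow> P y) \<Longrightarrow> P x"
  proof (induction x rule: measure_induct_rule[of "\<lambda>x. finite_code (of_copy x)"])
    case (less x)
    show ?case by (rule that) (rule less, simp add: less_ordered_copy_def)
  qed
qed

end

definition reindex :: "('m \<Rightarrow> 'n) \<Rightarrow> real^'n \<Rightarrow> real^'m" where
  "reindex \<pi> x = (\<chi> i. x $ \<pi> i)"

lemma reindex_nth [simp]: "reindex \<pi> x $ i = x $ \<pi> i"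
  by (simp add: reindex_def)

lemma linear_reindex: "linear (reindex \<pi> :: real^'n::finite \<Rightarrow> real^'m::finite)"
  by (rule linearI) (simp_all add: vec_eq_iff)

context
  fixes \<pi> :: "'m::finite \<Rightarrow> 'n::finite"
  assumes bij: "bij \<pi>"
begin

lemma reindex_inverse: "reindex \<pi> (reindex (inv \<pi>) y) = y" "reindex (inv \<pi>) (reindex \<pi> x) = x"
  using bij by (simp_all add: vec_eq_iff bij_is_inj bij_is_surj surj_f_inv_f)

lemma norm_reindex: "norm (reindex \<pi> x) = norm x"
proof -
  have "(\<Sum>i\<in>UNIV. (x $ \<pi> i)\<^sup>2) = (\<Sum>j\<in>UNIV. (x $ j)\<^sup>2)"
    by (rule sum.reindex_bij_betw[OF bij])
  then show ?thesis by (simp add: norm_eq_sqrt_inner inner_vec_def power2_eq_square)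
qed

lemma reindex_image_cbox: "reindex \<pi> ` cbox u v = cbox (reindex \<pi> u) (reindex \<pi> v)"
proof safe
  fix x assume "x \<in> cbox u v" then show "reindex \<pi> x \<in> cbox (reindex \<pi> u) (reindex \<pi> v)"
    by (simp add: mem_box_cart)
next
  fix y assume y: "y \<in> cbox (reindex \<pi> u) (reindex \<pi> v)"
  have "u $ j \<le> y $ inv \<pi> j \<and> y $ inv \<pi> j \<le> v $ j" for j
  proof -
    have "\<pi> (inv \<pi> j) = j" using bij by (simp add: bij_is_surj surj_f_inv_f)
    then show ?thesis using y[unfolded mem_box_cart] by (metis reindex_nth)
  qed
  then have "reindex (inv \<pi>) y \<in> cbox u v"
    by (simp add: mem_box_cart)
  then show "y \<in> reindex \<pi> ` cbox u v"
    using reindex_inverse(1)[of y] by (metis imageI)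
qed

lemma content_reindex_cbox: "measure lborel (cbox (reindex \<pi> u) (reindex \<pi> v)) = measure lborel (cbox u v)"
proof -
  have "(\<Prod>i\<in>UNIV. v $ \<pi> i - u $ \<pi> i) = (\<Prod>j\<in>UNIV. v $ j - u $ j)"
    by (rule prod.reindex_bij_betw[OF bij])
  moreover have "cbox (reindex \<pi> u) (reindex \<pi> v) = {} \<longleftrightarrow> cbox u v = {}"
    unfolding reindex_image_cbox[symmetric] by simp
  ultimately show ?thesis by (simp add: content_cbox_if_cart)
qed

end

lemma has_integral_reindex_cbox:
  fixes \<pi> :: "'m::finite \<Rightarrow> 'n::finite" and f :: "real^'n \<Rightarrow> real"
  assumes bij: "bij \<pi>" and f: "(f has_integral I) (cbox a b)"
  shows "((\<lambda>y. f (reindex (inv \<pi>) y)) has_integral I) (cbox (reindex \<pi> a) (reindex \<pi> b))"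
proof -
  have bij': "bij (inv \<pi>)" by (simp add: bij bij_imp_bij_inv)
  have "((\<lambda>y. f (reindex (inv \<pi>) y)) has_integral (1 / 1) *\<^sub>R I) (reindex \<pi> ` cbox a b)"
  proof (rule has_integral_twiddle)
    show "\<exists>w z. reindex \<pi> ` cbox u v = cbox w z" for u v
      using reindex_image_cbox[OF bij] by blast
    show "\<exists>w z. reindex (inv \<pi>) ` cbox u v = cbox w z" for u v
      using reindex_image_cbox[OF bij'] by blast
    show "measure lborel (reindex (inv \<pi>) ` cbox u v) = 1 * measure lborel (cbox u v)" for u v
      using reindex_image_cbox[OF bij'] content_reindex_cbox[OF bij'] by simp
    show "isCont (reindex (inv \<pi>)) x" for x
      by (rule linear_continuous_at) (use linear_reindex linear_conv_bounded_linear in blast)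
      show "(f has_integral I) (cbox a b)" by (rule f)
    show "reindex \<pi> (reindex (inv \<pi>) x) = x" "reindex (inv \<pi>) (reindex \<pi> y) = y" for x y
      by (rule reindex_inverse[OF bij])+
  qed simp
  then show ?thesis by (simp add: reindex_image_cbox[OF bij])
qed

text \<open>
  A permutation of coordinates is an isometry that maps boxes to boxes of the same volume.
\<close>

lemma has_integral_reindex:
  fixes \<pi> :: "'m::finite \<Rightarrow> 'n::finite" and f :: "real^'n \<Rightarrow> real"
  assumes bij: "bij \<pi>" and f: "(f has_integral I) S"
  shows "((\<lambda>y. f (reindex (inv \<pi>) y)) has_integral I) (reindex \<pi> ` S)"
proof -
  let ?f = "\<lambda>x. if x \<in> S then f x else 0"
  let ?g = "\<lambda>y. if y \<in> reindex \<pi> ` S then f (reindex (inv \<pi>) y) else 0"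
  have bij': "bij (inv \<pi>)" by (simp add: bij bij_imp_bij_inv)
  have iff: "y \<in> reindex \<pi> ` S \<longleftrightarrow> reindex (inv \<pi>) y \<in> S" for y
  proof
    show "reindex (inv \<pi>) y \<in> S" if "y \<in> reindex \<pi> ` S"
      using that reindex_inverse(2)[OF bij] by auto
    show "y \<in> reindex \<pi> ` S" if "reindex (inv \<pi>) y \<in> S"
      using imageI[OF that, of "reindex \<pi>"] by (simp add: reindex_inverse(1)[OF bij])
  qed
  have eq: "?g y = ?f (reindex (inv \<pi>) y)" for y by (simp add: iff)
  have fint: "\<And>a b. ?f integrable_on cbox a b"
    and fB: "\<And>e. e > 0 \<Longrightarrow> \<exists>B>0. \<forall>a b. ball 0 B \<subseteq> cbox a b \<longrightarrow> norm (integral (cbox a b) ?f - I) < e"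
    using f unfolding has_integral_alt'[of f I S] by blast+
  have gint: "(?g has_integral integral (cbox (reindex (inv \<pi>) a) (reindex (inv \<pi>) b)) ?f) (cbox a b)" for a b
  proof -
    have "(?f has_integral integral (cbox (reindex (inv \<pi>) a) (reindex (inv \<pi>) b)) ?f)
             (cbox (reindex (inv \<pi>) a) (reindex (inv \<pi>) b))"
      by (rule integrable_integral[OF fint])
    from has_integral_reindex_cbox[OF bij this] show ?thesis
      by (simp only: reindex_inverse[OF bij] eq)
  qed
  show ?thesis
    unfolding has_integral_alt'[of _ I "reindex \<pi> ` S"]
  proof (intro conjI allI impI)
    show "?g integrable_on cbox a b" for a b using gint by blast
    fix e :: real assume "e > 0"
    then obtain B where B: "B > 0" "\<And>a b. ball 0 B \<subseteq> cbox a b \<Longrightarrow> norm (integral (cbox a b) ?f - I) < e"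
      using fB by blast
    have "norm (integral (cbox a b) ?g - I) < e" if ab: "ball 0 B \<subseteq> cbox a b" for a b
    proof -
      have "ball 0 B \<subseteq> cbox (reindex (inv \<pi>) a) (reindex (inv \<pi>) b)"
      proof
        fix x :: "real^'n" assume "x \<in> ball 0 B"
        then have "reindex \<pi> x \<in> cbox a b" using ab norm_reindex[OF bij] by auto
        then have "reindex (inv \<pi>) (reindex \<pi> x) \<in> reindex (inv \<pi>) ` cbox a b" by blast
        then show "x \<in> cbox (reindex (inv \<pi>) a) (reindex (inv \<pi>) b)"
          by (simp add: reindex_inverse[OF bij] reindex_image_cbox[OF bij'])
      qed
      from B(2)[OF this] show ?thesis using integral_unique[OF gint] by simp
    qed
    with B(1) show "\<exists>B>0. \<forall>a b. ball 0 B \<subseteq> cbox a b \<longrightarrow> norm (integral (cbox a b) ?g - I) < e" by blast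
  qed
qed

text \<open>
  Conjugation by \<open>\<pi>\<close> is a sign-preserving bijection between the permutations of the two index types.
\<close>

lemma det_reindex:
  fixes A :: "real^'n::finite^'n" and \<pi> :: "'m::finite \<Rightarrow> 'n"
  assumes bij: "bij \<pi>"
  shows "det (\<chi> i j. A $ \<pi> i $ \<pi> j) = det A"
proof -
  have bij': "bij (inv \<pi>)" by (simp add: bij bij_imp_bij_inv)
  have inv: "bij_betw \<pi> UNIV UNIV" "bij_betw (inv \<pi>) UNIV UNIV" using bij bij' by simp_all
  have inj: "inj \<pi>" and surj: "surj \<pi>" using bij by (auto simp: bij_def)
  show ?thesis
    unfolding det_def
  proof (rule sum.reindex_bij_witness[where i = "map_permutation UNIV (inv \<pi>)" and j = "map_permutation UNIV \<pi>"])
    fix p :: "'m \<Rightarrow> 'm" assume p: "p \<in> {p. p permutes UNIV}"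
    show "map_permutation UNIV (inv \<pi>) (map_permutation UNIV \<pi> p) = p"
      using p inj by (intro map_permutation_compose_inv[OF inv(1)]) auto
    show "map_permutation UNIV \<pi> p \<in> {p. p permutes UNIV}"
      using p map_permutation_permutes[OF inv(1)] by auto
    have "(\<Prod>i\<in>UNIV. A $ i $ map_permutation UNIV \<pi> p i) = (\<Prod>i\<in>UNIV. A $ \<pi> i $ map_permutation UNIV \<pi> p (\<pi> i))"
      by (rule prod.reindex_bij_betw[OF inv(1), symmetric])
    also have "\<dots> = (\<Prod>i\<in>UNIV. A $ \<pi> i $ \<pi> (p i))"
      using inj by (simp add: map_permutation_apply)
    finally show "of_int (sign (map_permutation UNIV \<pi> p)) * (\<Prod>i\<in>UNIV. A $ i $ map_permutation UNIV \<pi> p i)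
      = of_int (sign p) * (\<Prod>i\<in>UNIV. (\<chi> i j. A $ \<pi> i $ \<pi> j) $ i $ p i)"
      using p inj by (simp add: sign_map_permutation)
  next
    fix q :: "'n \<Rightarrow> 'n" assume q: "q \<in> {p. p permutes UNIV}"
    show "map_permutation UNIV \<pi> (map_permutation UNIV (inv \<pi>) q) = q"
      using q surj by (intro map_permutation_compose_inv[OF inv(2)]) (auto simp: surj_f_inv_f)
    show "map_permutation UNIV (inv \<pi>) q \<in> {p. p permutes UNIV}"
      using q map_permutation_permutes[OF inv(2)] by auto
  qed
qed

lemma change_of_variables_nonneg_wellorder:
  fixes g :: "real^'n::{finite,wellorder} \<Rightarrow> real^'n::_" and f :: "real^'n::_ \<Rightarrow> real"
  assumes S: "S \<in> sets lebesgue"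
    and der: "\<And>x. x \<in> S \<Longrightarrow> (g has_derivative (\<lambda>h. M x *v h)) (at x)"
    and inj: "inj_on g S" and f: "\<And>x. x \<in> S \<Longrightarrow> 0 \<le> f (g x)"
    and int: "((\<lambda>x. \<bar>det (M x)\<bar> * f (g x)) has_integral I) S"
  shows "(f has_integral I) (g ` S)"
proof -
  have der': "(g has_derivative (\<lambda>h. M x *v h)) (at x within S)" if "x \<in> S" for x
    using der[OF that] by (rule has_derivative_at_withinI)
  have "(\<lambda>x. \<bar>det (M x)\<bar> * f (g x)) absolutely_integrable_on S"
    using int f by (intro nonnegative_absolutely_integrable_1) auto
  moreover have "integral S (\<lambda>x. \<bar>det (M x)\<bar> * f (g x)) = I" using int by blast
  ultimately have "(\<lambda>x. vec (f x) :: real^1) absolutely_integrable_on (g ` S) \<and> integral (g ` S) (\<lambda>x. vec (f x) :: real^1) = vec I"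
    by (intro iffD1[OF has_absolute_integral_change_of_variables[OF S der' inj]])
       (simp_all add: absolutely_integrable_on_1_iff integral_on_1_eq)
  then have "f absolutely_integrable_on (g ` S)" "integral (g ` S) f = I"
    by (simp_all add: absolutely_integrable_on_1_iff integral_on_1_eq)
  then show ?thesis by (auto simp: has_integral_iff absolutely_integrable_on_def)
qed

text \<open>
  The well-ordered case is transported along the coordinate permutation \<open>reindex of_copy\<close>, which
  changes neither integrals nor Jacobian determinants.
\<close>

proposition change_of_variables_nonneg:
  fixes g :: "real^'n::finite \<Rightarrow> real^'n" and f :: "real^'n \<Rightarrow> real"
  assumes S: "open S"
    and der: "\<And>x. x \<in> S \<Longrightarrow> (g has_derivative (\<lambda>h. M x *v h)) (at x)"
    and inj: "inj_on g S" and f: "\<And>x. x \<in> S \<Longrightarrow> 0 \<le> f (g x)"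
    and int: "((\<lambda>x. \<bar>det (M x)\<bar> * f (g x)) has_integral I) S"
  shows "(f has_integral I) (g ` S)"
proof -
  define \<pi> where "\<pi> = (of_copy :: 'n ordered_copy \<Rightarrow> 'n)"
  have bij: "bij \<pi>" unfolding \<pi>_def by (rule bij_of_copy)
  then have bij': "bij (inv \<pi>)" and invinv: "inv (inv \<pi>) = \<pi>"
    by (simp_all add: bij_imp_bij_inv inv_inv_eq)
  note ri = reindex_inverse[OF bij]
  let ?R = "reindex \<pi>" and ?R' = "reindex (inv \<pi>)"
  have blR: "bounded_linear ?R" "bounded_linear ?R'"
    using linear_reindex linear_conv_bounded_linear by blast+
  define g' where "g' = ?R \<circ> g \<circ> ?R'"
  define M' where "M' y = (\<chi> i j. M (?R' y) $ \<pi> i $ \<pi> j)" for y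
  have detM': "det (M' y) = det (M (?R' y))" for y
    unfolding M'_def by (rule det_reindex[OF bij])
  have img: "?R ` S = ?R' -` S" proof -
    have "y \<in> ?R ` S" if "?R' y \<in> S" for y using imageI[OF that, of ?R] by (simp add: ri)
    then show ?thesis by (auto simp: ri)
  qed
  have "open (?R ` S)"
    unfolding img using blR(2) S by (simp add: linear_continuous_on open_vimage bounded_linear.continuous_on)
  then have meas: "?R ` S \<in> sets lebesgue" by (simp add: borel_open)
  have R: "?R (M x *v (?R' h)) = M' (?R x) *v h" for x h
  proof -
    have "(\<Sum>j\<in>UNIV. M x $ \<pi> i $ j * h $ inv \<pi> j) = (\<Sum>j\<in>UNIV. M x $ \<pi> i $ \<pi> j * h $ inv \<pi> (\<pi> j))" for i
      by (rule sum.reindex_bij_betw[OF bij, symmetric])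
    then show ?thesis
      using bij by (simp add: vec_eq_iff matrix_vector_mult_def M'_def ri bij_is_inj)
  qed
  have der': "(g' has_derivative (\<lambda>h. M' y *v h)) (at y)" if y: "y \<in> ?R ` S" for y
  proof -
    have "?R' y \<in> S" using y img by auto
    have "((\<lambda>y. ?R (g (?R' y))) has_derivative (\<lambda>h. ?R (M (?R' y) *v ?R' h))) (at y)"
      by (intro bounded_linear.has_derivative[OF blR(1)] has_derivative_compose[OF _ der]
           bounded_linear_imp_has_derivative blR \<open>?R' y \<in> S\<close>)
    then show ?thesis by (simp add: R ri g'_def o_def)
  qed
  have inj': "inj_on g' (?R ` S)"
    using inj by (auto simp: inj_on_def g'_def ri) (metis ri(2))
  have int': "((\<lambda>y. \<bar>det (M' y)\<bar> * f (?R' (g' y))) has_integral I) (?R ` S)"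
    using has_integral_reindex[OF bij int] by (simp add: detM' g'_def ri)
  have "((\<lambda>y. f (?R' y)) has_integral I) (g' ` ?R ` S)"
    by (rule change_of_variables_nonneg_wellorder[OF meas der' inj' _ int'])
       (auto simp: g'_def ri f)
  from has_integral_reindex[OF bij' this]
  have "(f has_integral I) (?R' ` g' ` ?R ` S)" by (simp add: invinv ri)
  moreover have "?R' ` g' ` ?R ` S = g ` S" by (simp add: image_image g'_def ri)
  ultimately show ?thesis by simp
qed

section \<open>Legendre transforms over compact sets\<close>

definition legendre :: "'a::euclidean_space set \<Rightarrow> ('a \<Rightarrow> real) \<Rightarrow> 'a \<Rightarrow> real" where
  "legendre K w \<xi> = (SUP y\<in>K. \<xi> \<bullet> y - w y)"

context
  fixes K :: "'a::euclidean_space set" and w :: "'a \<Rightarrow> real"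
  assumes K: "compact K" "K \<noteq> {}" and w: "continuous_on K w"
begin

lemma legendre_attained:
  obtains y where "y \<in> K" "legendre K w \<xi> = \<xi> \<bullet> y - w y"
    "\<And>z. z \<in> K \<Longrightarrow> \<xi> \<bullet> z - w z \<le> legendre K w \<xi>"
proof -
  have "continuous_on K (\<lambda>y. \<xi> \<bullet> y - w y)" by (intro continuous_intros w)
  then obtain y where y: "y \<in> K" "\<And>z. z \<in> K \<Longrightarrow> \<xi> \<bullet> z - w z \<le> \<xi> \<bullet> y - w y"
    using continuous_attains_sup[OF K, of "\<lambda>y. \<xi> \<bullet> y - w y"] by blast
  then have "legendre K w \<xi> = \<xi> \<bullet> y - w y"
    unfolding legendre_def by (intro cSup_eq_maximum) auto
  with y that show ?thesis by metis
qed

lemma legendre_ge: "z \<in> K \<Longrightarrow> \<xi> \<bullet> z - w z \<le> legendre K w \<xi>"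
  by (rule legendre_attained[of \<xi>]) blast

lemma legendre_le: "(\<And>z. z \<in> K \<Longrightarrow> \<xi> \<bullet> z - w z \<le> c) \<Longrightarrow> legendre K w \<xi> \<le> c"
  by (rule legendre_attained[of \<xi>]) simp

lemma legendre_diff_le:
  assumes "K \<subseteq> cball 0 B"
  shows "\<bar>legendre K w \<xi> - legendre K w \<eta>\<bar> \<le> B * norm (\<xi> - \<eta>)"
proof -
  have *: "legendre K w \<xi> \<le> legendre K w \<eta> + B * norm (\<xi> - \<eta>)" for \<xi> \<eta>
  proof (rule legendre_le)
    fix z assume z: "z \<in> K"
    have "(\<xi> - \<eta>) \<bullet> z \<le> norm (\<xi> - \<eta>) * norm z" by (rule norm_cauchy_schwarz)
    also have "\<dots> \<le> norm (\<xi> - \<eta>) * B" using z assms by (intro mult_left_mono) auto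
    finally show "\<xi> \<bullet> z - w z \<le> legendre K w \<eta> + B * norm (\<xi> - \<eta>)"
      using legendre_ge[OF z, of \<eta>] by (simp add: inner_diff_left mult.commute)
  qed
  show ?thesis using *[of \<xi> \<eta>] *[of \<eta> \<xi>] by (simp add: abs_le_iff norm_minus_commute)
qed

lemma continuous_on_legendre: "continuous_on S (legendre K w)"
proof -
  obtain B where B: "K \<subseteq> cball 0 B" "B > 0"
    using compact_imp_bounded[OF K(1)] by (metis bounded_subset_ballD ball_subset_cball order_trans less_le)
  have "B-lipschitz_on S (legendre K w)"
    using legendre_diff_le[OF B(1)] B(2) by (intro lipschitz_onI) (auto simp: dist_norm)
  then show ?thesis by (rule lipschitz_on_continuous_on)
qed

text \<open>
  The transform reverses order and turns an added constant into a subtracted one; used in both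
  directions, this makes it a contraction for the uniform distance.
\<close>

lemma legendre_perturb:
  assumes v: "continuous_on K v" and le: "\<And>y. y \<in> K \<Longrightarrow> w y \<le> v y + e"
  shows "legendre K v \<xi> \<le> legendre K w \<xi> + e"
proof -
  obtain y where "y \<in> K" "legendre K v \<xi> = \<xi> \<bullet> y - v y"
  proof -
    have "continuous_on K (\<lambda>y. \<xi> \<bullet> y - v y)" by (intro continuous_intros v)
    then obtain y where y: "y \<in> K" "\<And>z. z \<in> K \<Longrightarrow> \<xi> \<bullet> z - v z \<le> \<xi> \<bullet> y - v y"
      using continuous_attains_sup[OF K, of "\<lambda>y. \<xi> \<bullet> y - v y"] by blast
    then have "legendre K v \<xi> = \<xi> \<bullet> y - v y"
      unfolding legendre_def by (intro cSup_eq_maximum) auto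
    with y that show ?thesis by metis
  qed
  then show ?thesis using le[of y] legendre_ge[of y \<xi>] by simp
qed

end

lemma legendre_diff_const:
  assumes "compact K" "K \<noteq> {}" "continuous_on K w"
  shows "legendre K (\<lambda>y. w y - c) \<xi> = legendre K w \<xi> + c"
proof (rule antisym)
  have *: "continuous_on K (\<lambda>y. w y - c)" by (intro continuous_intros assms)
  show "legendre K (\<lambda>y. w y - c) \<xi> \<le> legendre K w \<xi> + c"
    using legendre_perturb[OF assms *, of c] by simp
  show "legendre K w \<xi> + c \<le> legendre K (\<lambda>y. w y - c) \<xi>"
    using legendre_perturb[OF assms(1,2) * assms(3), of "- c" \<xi>] by simp
qed

lemma biconjugate_le:
  assumes K: "compact K" "K \<noteq> {}" "continuous_on K w" and C: "compact C" "C \<noteq> {}" and x: "x \<in> K"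
  shows "legendre C (legendre K w) x \<le> w x"
proof (rule legendre_le[OF C continuous_on_legendre[OF K]])
  fix \<xi> show "x \<bullet> \<xi> - legendre K w \<xi> \<le> w x"
    using legendre_ge[OF K x, of \<xi>] by (simp add: inner_commute)
qed

lemma legendre_biconjugate_le:
  assumes K: "compact K" "K \<noteq> {}" "continuous_on K w" and C: "compact C" "C \<noteq> {}" and \<xi>: "\<xi> \<in> C"
  shows "legendre K (legendre C (legendre K w)) \<xi> \<le> legendre K w \<xi>"
proof (rule legendre_le[OF K(1,2) continuous_on_legendre[OF C continuous_on_legendre[OF K]]])
  fix x show "\<xi> \<bullet> x - legendre C (legendre K w) x \<le> legendre K w \<xi>"
    using legendre_ge[OF C continuous_on_legendre[OF K] \<xi>, of x] by (simp add: inner_commute)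
qed

section \<open>Minimising the Kantorovich dual functional\<close>

lemma integrable_on_bounded_continuous:
  fixes f :: "'a::euclidean_space \<Rightarrow> real"
  assumes S: "S \<in> lmeasurable" and f: "continuous_on S f" and b: "bounded (f ` S)"
  shows "f integrable_on S"
proof -
  obtain B where "\<And>x. x \<in> S \<Longrightarrow> \<bar>f x\<bar> \<le> B" using b unfolding bounded_iff by auto
  moreover have "(\<lambda>x. B) integrable_on S" using S by (rule integrable_on_const)
  ultimately show ?thesis
    using S f by (intro measurable_bounded_by_integrable_imp_integrable[of f S "\<lambda>x. B"]
        continuous_imp_measurable_on_sets_lebesgue) (auto simp: fmeasurableD)
qed

lemma integrable_on_compact_closure:
  fixes f :: "'a::euclidean_space \<Rightarrow> real"
  assumes S: "S \<in> lmeasurable" "bounded S" and f: "continuous_on (closure S) f"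
  shows "f integrable_on S"
proof (rule integrable_on_bounded_continuous[OF S(1)])
  show "continuous_on S f" using f continuous_on_subset closure_subset by blast
  have "compact (f ` closure S)" using f S(2) by (intro compact_continuous_image) auto
  then show "bounded (f ` S)"
    by (rule bounded_subset[OF compact_imp_bounded]) (intro image_mono closure_subset)
qed

text \<open>
  The dual of the optimal transport problem, with cost \<open>- x \<bullet> \<xi>\<close>, between Lebesgue measure on \<open>\<Omega>\<close>
  and the density \<open>g\<close> on \<open>C\<close>.
\<close>

definition kantorovich_dual :: "'a::euclidean_space set \<Rightarrow> 'a set \<Rightarrow> ('a \<Rightarrow> real) \<Rightarrow> ('a \<Rightarrow> real) \<Rightarrow> real" where
  "kantorovich_dual \<Omega> C g w = integral \<Omega> w + integral C (\<lambda>\<xi>. legendre (closure \<Omega>) w \<xi> * g \<xi>)"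

locale balanced_transport =
  fixes \<Omega> C :: "'a::euclidean_space set" and g :: "'a \<Rightarrow> real"
  assumes \<Omega>: "open \<Omega>" "bounded \<Omega>" "\<Omega> \<noteq> {}"
    and C: "compact C" "C \<noteq> {}"
    and g: "continuous_on C g" "\<And>\<xi>. \<xi> \<in> C \<Longrightarrow> 0 \<le> g \<xi>"
    and balance: "integral C g = measure lebesgue \<Omega>"
begin

lemma \<Omega>_lmeasurable: "\<Omega> \<in> lmeasurable"
  using \<Omega> by (simp add: bounded_set_imp_lmeasurable borel_open)

lemma compact_closure_\<Omega>: "compact (closure \<Omega>)" "closure \<Omega> \<noteq> {}"
  using \<Omega> by auto

lemma integral_const_\<Omega>: "integral \<Omega> (\<lambda>x. c) = c * measure lebesgue \<Omega>"
  using integral_mult_right[of \<Omega> c "\<lambda>x. 1"] lmeasure_integral[OF \<Omega>_lmeasurable] by simp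

lemma legendre_weight_integrable:
  assumes "continuous_on (closure \<Omega>) w"
  shows "(\<lambda>\<xi>. legendre (closure \<Omega>) w \<xi> * g \<xi>) integrable_on C"
  using C by (intro integrable_on_compact_closure lmeasurable_compact continuous_intros compact_imp_bounded)
    (auto simp: compact_imp_closed closure_closed intro!: g continuous_on_legendre[OF compact_closure_\<Omega> assms])

lemma kantorovich_dual_perturb:
  assumes w: "continuous_on (closure \<Omega>) w" and v: "continuous_on (closure \<Omega>) v"
    and e: "\<And>y. y \<in> closure \<Omega> \<Longrightarrow> \<bar>w y - v y\<bar> \<le> e"
  shows "kantorovich_dual \<Omega> C g w \<le> kantorovich_dual \<Omega> C g v + 2 * e * measure lebesgue \<Omega>"
proof -
  note iw = integrable_on_compact_closure[OF \<Omega>_lmeasurable \<Omega>(2)]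
  have ie: "(\<lambda>x. e) integrable_on \<Omega>" by (rule integrable_on_const[OF \<Omega>_lmeasurable])
  have "integral \<Omega> w \<le> integral \<Omega> (\<lambda>x. v x + e)"
  proof (rule integral_le)
    fix x assume "x \<in> \<Omega>"
    then show "w x \<le> v x + e" using e[of x] closure_subset by fastforce
  qed (intro iw w integrable_add v ie)+
  also have "\<dots> = integral \<Omega> v + e * measure lebesgue \<Omega>"
    using integral_add[OF iw[OF v] ie] by (simp add: integral_const_\<Omega>)
  finally have 1: "integral \<Omega> w \<le> integral \<Omega> v + e * measure lebesgue \<Omega>" .
  have gi: "(\<lambda>\<xi>. e * g \<xi>) integrable_on C"
    using C by (intro integrable_on_compact_closure lmeasurable_compact compact_imp_bounded)
      (auto simp: compact_imp_closed closure_closed intro!: continuous_on_mult_left g)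
  have "integral C (\<lambda>\<xi>. legendre (closure \<Omega>) w \<xi> * g \<xi>) \<le> integral C (\<lambda>\<xi>. legendre (closure \<Omega>) v \<xi> * g \<xi> + e * g \<xi>)"
  proof (rule integral_le)
    fix \<xi> assume \<xi>: "\<xi> \<in> C"
    have "legendre (closure \<Omega>) w \<xi> \<le> legendre (closure \<Omega>) v \<xi> + e"
      using e by (intro legendre_perturb compact_closure_\<Omega> v w) (simp add: abs_le_iff, fastforce)
    from mult_right_mono[OF this g(2)[OF \<xi>]]
    show "legendre (closure \<Omega>) w \<xi> * g \<xi> \<le> legendre (closure \<Omega>) v \<xi> * g \<xi> + e * g \<xi>"
      by (simp add: distrib_right)
  qed (intro legendre_weight_integrable w v integrable_add gi)+
  also have "\<dots> = integral C (\<lambda>\<xi>. legendre (closure \<Omega>) v \<xi> * g \<xi>) + e * measure lebesgue \<Omega>"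
    by (simp add: integral_add[OF legendre_weight_integrable[OF v] gi] balance)
  finally show ?thesis using 1 by (simp add: kantorovich_dual_def)
qed

text \<open>
  Adding a constant to \<open>w\<close> changes the two integrals by opposite amounts because the two measures
  have equal mass. Minimising sequences can therefore be normalised at a base point.
\<close>

lemma kantorovich_dual_shift:
  assumes w: "continuous_on (closure \<Omega>) w"
  shows "kantorovich_dual \<Omega> C g (\<lambda>x. w x - c) = kantorovich_dual \<Omega> C g w"
proof -
  have ic: "(\<lambda>x. c) integrable_on \<Omega>" by (rule integrable_on_const[OF \<Omega>_lmeasurable])
  have gi: "(\<lambda>\<xi>. c * g \<xi>) integrable_on C"
    using C by (intro integrable_on_compact_closure lmeasurable_compact compact_imp_bounded)
      (auto simp: compact_imp_closed closure_closed intro!: continuous_on_mult_left g)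
  have "integral \<Omega> (\<lambda>x. w x - c) = integral \<Omega> w - c * measure lebesgue \<Omega>"
    using integral_diff[OF integrable_on_compact_closure[OF \<Omega>_lmeasurable \<Omega>(2) w] ic] by (simp add: integral_const_\<Omega>)
  moreover have "integral C (\<lambda>\<xi>. legendre (closure \<Omega>) (\<lambda>x. w x - c) \<xi> * g \<xi>)
     = integral C (\<lambda>\<xi>. legendre (closure \<Omega>) w \<xi> * g \<xi>) + c * measure lebesgue \<Omega>"
    using integral_add[OF legendre_weight_integrable[OF w] gi]
    by (simp add: legendre_diff_const[OF compact_closure_\<Omega> w] distrib_right balance)
  ultimately show ?thesis by (simp add: kantorovich_dual_def)
qed

lemma kantorovich_dual_biconjugate_le:
  assumes w: "continuous_on (closure \<Omega>) w"
  shows "kantorovich_dual \<Omega> C g (legendre C (legendre (closure \<Omega>) w)) \<le> kantorovich_dual \<Omega> C g w"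
proof -
  note K = compact_closure_\<Omega>
  have w': "continuous_on S (legendre C (legendre (closure \<Omega>) w))" for S
    by (intro continuous_on_legendre C K w)
  have "integral \<Omega> (legendre C (legendre (closure \<Omega>) w)) \<le> integral \<Omega> w"
    using closure_subset
    by (intro integral_le integrable_on_compact_closure \<Omega>_lmeasurable \<Omega> w w' biconjugate_le K C) auto
  moreover have "integral C (\<lambda>\<xi>. legendre (closure \<Omega>) (legendre C (legendre (closure \<Omega>) w)) \<xi> * g \<xi>)
      \<le> integral C (\<lambda>\<xi>. legendre (closure \<Omega>) w \<xi> * g \<xi>)"
    by (intro integral_le legendre_weight_integrable w w' mult_right_mono legendre_biconjugate_le K C g)
  ultimately show ?thesis by (simp add: kantorovich_dual_def)
qed

text \<open>
  It suffices to minimise over the functions that are Lipschitz with a bound for \<open>C\<close> as constant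
  and vanish at a base point: biconjugation followed by subtraction of a constant leads there without
  increasing the functional. This class is bounded and equicontinuous, and the functional is
  continuous for uniform convergence. One more biconjugation puts the minimiser into the form
  \<open>legendre C h\<close>, which is convex and defined on the whole space.
\<close>

proposition kantorovich_dual_minimizer:
  obtains h where "continuous_on C h"
    "\<And>v. continuous_on (closure \<Omega>) v \<Longrightarrow> kantorovich_dual \<Omega> C g (legendre C h) \<le> kantorovich_dual \<Omega> C g v"
proof -
  note K = compact_closure_\<Omega>
  let ?K = "closure \<Omega>" and ?J = "kantorovich_dual \<Omega> C g" and ?m = "measure lebesgue \<Omega>"
  obtain x0 where x0: "x0 \<in> ?K" using \<Omega>(3) closure_subset by (metis ex_in_conv subsetD)
  obtain R where R: "C \<subseteq> cball 0 R" "R > 0"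
    using compact_imp_bounded[OF C(1)] by (metis bounded_subset_ballD ball_subset_cball order_trans less_le)
  define L where "L = {w. (\<forall>x\<in>?K. \<forall>y\<in>?K. \<bar>w x - w y\<bar> \<le> R * norm (x - y)) \<and> w x0 = 0}"
  have Lcont: "continuous_on ?K w" if "w \<in> L" for w
  proof -
    have "R-lipschitz_on ?K w"
      using that R by (intro lipschitz_onI) (auto simp: dist_norm L_def)
    then show ?thesis by (rule lipschitz_on_continuous_on)
  qed
  have 0: "(\<lambda>x. 0) \<in> L" using R by (simp add: L_def)
  obtain D where D: "\<And>x. x \<in> ?K \<Longrightarrow> norm (x - x0) \<le> D"
    using compact_imp_bounded[OF K(1)] bounded_any_center[of ?K x0] by (auto simp: dist_norm norm_minus_commute)
  have Lbound: "\<bar>w x\<bar> \<le> R * D" if "w \<in> L" "x \<in> ?K" for w x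
  proof -
    have "\<bar>w x - w x0\<bar> \<le> R * norm (x - x0)" using that x0 unfolding L_def by blast
    also have "\<dots> \<le> R * D" using D that R by simp
    finally show ?thesis using that by (simp add: L_def)
  qed
  have bdd: "bdd_below (?J ` L)"
  proof (rule bdd_belowI2)
    fix w assume w: "w \<in> L"
    have "?J (\<lambda>x. 0) \<le> ?J w + 2 * (R * D) * ?m"
      by (rule kantorovich_dual_perturb) (use Lcont 0 w Lbound in auto)
    then show "?J (\<lambda>x. 0) - 2 * (R * D) * ?m \<le> ?J w" by simp
  qed
  define I where "I = (INF w\<in>L. ?J w)"
  have "\<exists>w\<in>L. ?J w < I + 1 / real (Suc k)" for k
    using cINF_less_iff[OF _ bdd, of "I + 1 / real (Suc k)"] 0 unfolding I_def by auto
  then obtain W where W: "\<And>k. W k \<in> L" "\<And>k. ?J (W k) < I + 1 / real (Suc k)" by metis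
  have bnd: "norm (W n x) \<le> R * D" if "x \<in> ?K" for n x using Lbound[OF W(1) that] by simp
  have equi: "\<exists>d. 0 < d \<and> (\<forall>n y. y \<in> ?K \<and> norm (x - y) < d \<longrightarrow> norm (W n x - W n y) < e)"
    if "x \<in> ?K" "0 < e" for x e
  proof (intro exI[of _ "e / R"] conjI allI impI)
    show "0 < e / R" using that R by simp
    fix n y assume y: "y \<in> ?K \<and> norm (x - y) < e / R"
    have "\<bar>W n x - W n y\<bar> \<le> R * norm (x - y)" using W(1)[of n] y that unfolding L_def by blast
    also have "\<dots> < e" using y R by (simp add: field_simps)
    finally show "norm (W n x - W n y) < e" by simp
  qed
  obtain w and r :: "nat \<Rightarrow> nat" where w: "continuous_on ?K w" and r: "strict_mono r"
    and lim: "\<forall>e>0. \<exists>N. \<forall>n x. n \<ge> N \<and> x \<in> ?K \<longrightarrow> norm (W (r n) x - w x) < e"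
    by (rule Arzela_Ascoli[OF K(1) bnd equi]) blast+
  have JwI: "?J w \<le> I"
  proof (rule field_le_epsilon)
    fix e :: real assume e: "0 < e"
    have "\<exists>e'>0. 2 * e' * m \<le> e / 2" if "0 \<le> m" for m :: real
      using e that by (intro exI[of _ "e / (4 * (m + 1))"]) (auto simp: field_simps)
    then obtain e' where e': "e' > 0" and e'm: "2 * e' * ?m \<le> e / 2"
      using measure_nonneg by blast
    obtain N where N: "\<And>n x. n \<ge> N \<Longrightarrow> x \<in> ?K \<Longrightarrow> norm (W (r n) x - w x) < e'" using lim e' by blast
    obtain k where k: "1 / real (Suc k) < e / 2" using e nat_approx_posE[of "e / 2"] by auto
    define n where "n = max N k"
    have "r n \<ge> k" using seq_suble[OF r, of n] by (simp add: n_def)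
    then have "1 / real (Suc (r n)) \<le> 1 / real (Suc k)" by (simp add: frac_le)
    then have J: "?J (W (r n)) \<le> I + e / 2" using W(2)[of "r n"] k by linarith
    have "?J w \<le> ?J (W (r n)) + 2 * e' * ?m"
    proof (rule kantorovich_dual_perturb[OF w Lcont[OF W(1)]])
      fix y assume "y \<in> ?K"
      then show "\<bar>w y - W (r n) y\<bar> \<le> e'" using N[of n y] by (simp add: n_def abs_minus_commute)
    qed
    then show "?J w \<le> I + e" using J e'm by linarith
  qed
  have min: "?J w \<le> ?J v" if v: "continuous_on ?K v" for v
  proof -
    define v' where "v' = legendre C (legendre ?K v)"
    have h: "continuous_on C (legendre ?K v)" by (intro continuous_on_legendre K v)
    have v': "continuous_on ?K v'" unfolding v'_def by (intro continuous_on_legendre C h)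
    have "(\<lambda>x. v' x - v' x0) \<in> L"
      using legendre_diff_le[OF C h R(1)] by (simp add: L_def v'_def)
    then have "I \<le> ?J (\<lambda>x. v' x - v' x0)" unfolding I_def by (intro cINF_lower bdd)
    also have "\<dots> = ?J v'" by (rule kantorovich_dual_shift[OF v'])
    also have "\<dots> \<le> ?J v" unfolding v'_def by (rule kantorovich_dual_biconjugate_le[OF v])
    finally show ?thesis using JwI by simp
  qed
  show ?thesis
  proof (rule that[of "legendre ?K w"])
    show "continuous_on C (legendre ?K w)" by (intro continuous_on_legendre K w)
    show "?J (legendre C (legendre ?K w)) \<le> ?J v" if "continuous_on ?K v" for v
      using kantorovich_dual_biconjugate_le[OF w] min[OF that] by simp
  qed
qed

end

section \<open>The Monge-Ampere inequality at points of contact\<close>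

lemma continuous_on_det:
  fixes M :: "'a::topological_space \<Rightarrow> real^'n::finite^'n"
  assumes "continuous_on S M"
  shows "continuous_on S (\<lambda>x. det (M x))"
  unfolding det_def using assms by (intro continuous_intros)

text \<open>
  The competitor is \<open>v = min w (\<psi> - \<delta>)\<close> near \<open>x\<close>, written as \<open>w - \<rho>\<close>. A slope \<open>\<xi>\<close> whose conjugate
  value changes attains its supremum at a point \<open>y\<close> of \<open>U = {\<rho> > 0}\<close>; there \<open>v\<close> is the
  differentiable function \<open>\<psi> - \<delta>\<close>, whence \<open>\<xi> = G y\<close>, and the change is at most \<open>\<rho> y\<close>. The change of
  variables \<open>\<xi> = G y\<close> then bounds the increase of the conjugate integral by \<open>q \<integral>\<rho>\<close>, which is less
  than the decrease \<open>\<integral>\<rho>\<close> of the integral of \<open>w\<close>.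
\<close>

lemma transport_competitor:
  fixes \<Omega> C :: "(real^'n::finite) set" and M :: "real^'n \<Rightarrow> real^'n^'n"
  assumes bt: "balanced_transport \<Omega> C g"
    and gU: "continuous_on UNIV g" "\<And>\<xi>. 0 \<le> g \<xi>"
    and w: "continuous_on UNIV w"
    and s: "0 < s" "ball x s \<subseteq> \<Omega>"
    and d\<psi>: "\<And>y. y \<in> ball x s \<Longrightarrow> (\<psi> has_derivative (\<lambda>h. G y \<bullet> h)) (at y)"
    and dG: "\<And>y. y \<in> ball x s \<Longrightarrow> (G has_derivative (\<lambda>h. M y *v h)) (at y)"
    and M: "continuous_on (ball x s) M"
    and inj: "inj_on G (ball x s)"
    and q: "q < 1" "\<And>y. y \<in> ball x s \<Longrightarrow> \<bar>det (M y)\<bar> * g (G y) \<le> q"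
    and c: "0 < c" "\<And>y. y \<in> ball x s \<Longrightarrow> w y + c * (norm (y - x))\<^sup>2 \<le> \<psi> y" "\<psi> x = w x"
  shows "\<exists>v. continuous_on (closure \<Omega>) v \<and> kantorovich_dual \<Omega> C g v < kantorovich_dual \<Omega> C g w"
proof -
  interpret balanced_transport \<Omega> C g by (rule bt)
  note K = compact_closure_\<Omega>
  let ?K = "closure \<Omega>" and ?B = "ball x s"
  have \<psi>c: "continuous_on ?B \<psi>"
    by (intro continuous_at_imp_continuous_on ballI has_derivative_continuous[OF d\<psi>])
  have Gc: "continuous_on ?B G"
    by (intro continuous_at_imp_continuous_on ballI has_derivative_continuous[OF dG])
  have wK: "continuous_on S w" for S using w continuous_on_subset by blast
  \<comment> \<open>chosen so that the bump vanishes outside the ball of radius \<open>s / 2\<close>\<close>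
  define \<delta> where "\<delta> = c * s\<^sup>2 / 4"
  have \<delta>: "\<delta> > 0" using c s by (simp add: \<delta>_def)
  define k where "k y = w y - \<psi> y + \<delta>" for y
  define \<rho> where "\<rho> y = (if y \<in> ?B then max 0 (k y) else 0)" for y
  have kc: "continuous_on ?B k" unfolding k_def by (intro continuous_intros wK \<psi>c)
  have k_le: "k y \<le> \<delta> - c * (norm (y - x))\<^sup>2" if "y \<in> ?B" for y
    using c(2)[OF that] by (simp add: k_def)
  have kx: "k x = \<delta>" by (simp add: k_def c)
  have \<rho>0: "0 \<le> \<rho> y" for y by (simp add: \<rho>_def)
  have \<rho>le: "\<rho> y \<le> \<delta>" for y
  proof (cases "y \<in> ?B")
    case True
    have "0 \<le> c * (norm (y - x))\<^sup>2" using c by simp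
    then show ?thesis using k_le[OF True] \<delta> True by (simp add: \<rho>_def)
  qed (use \<delta> in \<open>simp add: \<rho>_def\<close>)
  have \<rho>far: "\<rho> y = 0" if "dist x y > s / 2" for y
  proof (cases "y \<in> ?B")
    case True
    have "(s / 2)\<^sup>2 \<le> (norm (y - x))\<^sup>2"
      using that s by (intro power_mono) (auto simp: dist_norm norm_minus_commute)
    then have "c * (s / 2)\<^sup>2 \<le> c * (norm (y - x))\<^sup>2" using c by simp
    then have "k y \<le> 0" using k_le[OF True] by (simp add: \<delta>_def power_divide)
    then show ?thesis by (simp add: \<rho>_def)
  qed (simp add: \<rho>_def)
  have \<rho>c: "continuous_on UNIV \<rho>"
  proof -
    have "continuous_on ?B \<rho>"
      by (rule continuous_on_eq[of _ "\<lambda>y. max 0 (k y)"]) (auto intro!: continuous_intros kc simp: \<rho>_def)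
    moreover have "continuous_on {y. dist x y > s / 2} \<rho>"
      by (rule continuous_on_eq[of _ "\<lambda>y. 0"]) (auto simp: \<rho>far)
    moreover have "open {y. dist x y > s / 2}" by (intro open_Collect_less continuous_intros)
    moreover have "?B \<union> {y. dist x y > s / 2} = UNIV" using s by force
    ultimately show ?thesis by (metis continuous_on_open_Un open_ball)
  qed
  then have \<rho>cS: "continuous_on S \<rho>" for S using continuous_on_subset by blast
  define U where "U = {y. 0 < \<rho> y}"
  have U_iff: "y \<in> U \<longleftrightarrow> y \<in> ?B \<and> 0 < k y" for y by (auto simp: U_def \<rho>_def max_def)
  then have UB: "U \<subseteq> ?B" by blast
  then have U\<Omega>: "U \<subseteq> \<Omega>" using s by blast
  have openU: "open U" unfolding U_def by (intro open_Collect_less continuous_intros \<rho>c)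
  have boundedU: "bounded U" using UB bounded_subset bounded_ball by blast
  then have lmU: "U \<in> lmeasurable" using openU by (simp add: bounded_set_imp_lmeasurable borel_open)
  have injU: "inj_on G U" using inj UB inj_on_subset by blast
  have \<rho>U: "\<rho> y = k y" if "y \<in> U" for y using that by (simp add: U_iff \<rho>_def)
  define v where "v y = w y - \<rho> y" for y
  have vK: "continuous_on S v" for S unfolding v_def by (intro continuous_intros wK \<rho>cS)

  define F where "F \<xi> = (if \<xi> \<in> G ` U then \<rho> (inv_into U G \<xi>) else 0)" for \<xi>
  have FG: "F (G y) = \<rho> y" if "y \<in> U" for y using that injU by (simp add: F_def)
  have F0: "0 \<le> F \<xi>" for \<xi> using \<rho>0 by (simp add: F_def)
  have legendre_le: "legendre ?K v \<xi> \<le> legendre ?K w \<xi> + F \<xi>" for \<xi>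
  proof -
    obtain y where y: "y \<in> ?K" "legendre ?K v \<xi> = \<xi> \<bullet> y - v y"
      and ymax: "\<And>z. z \<in> ?K \<Longrightarrow> \<xi> \<bullet> z - v z \<le> legendre ?K v \<xi>"
      by (rule legendre_attained[OF K vK, of \<xi>]) blast
    have wle: "\<xi> \<bullet> y - w y \<le> legendre ?K w \<xi>" by (rule legendre_ge[OF K wK y(1)])
    show ?thesis
    proof (cases "y \<in> U")
      case False
      then have "\<rho> y = 0" using \<rho>0[of y] by (simp add: U_def)
      then show ?thesis using y wle F0[of \<xi>] by (simp add: v_def)
    next
      case True
      have d: "((\<lambda>z. \<xi> \<bullet> z - \<psi> z) has_derivative (\<lambda>h. \<xi> \<bullet> h - G y \<bullet> h)) (at y)"
        using True UB by (auto intro!: derivative_eq_intros d\<psi>)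
      have "\<xi> \<bullet> z - \<psi> z \<le> \<xi> \<bullet> y - \<psi> y" if "z \<in> U" for z
      proof -
        have "z \<in> ?K" using that U\<Omega> closure_subset by blast
        from ymax[OF this] show ?thesis using that True y by (simp add: v_def \<rho>U k_def)
      qed
      then have "(\<lambda>h. \<xi> \<bullet> h - G y \<bullet> h) = (\<lambda>h. 0)"
        by (intro differential_zero_maxmin[OF True openU d]) auto
      then have "(\<xi> - G y) \<bullet> (\<xi> - G y) = 0" by (metis inner_diff_left)
      then have "\<xi> = G y" by simp
      then have "F \<xi> = \<rho> y" using FG True by simp
      then show ?thesis using y wle by (simp add: v_def)
    qed
  qed

  have int\<rho>: "\<rho> integrable_on U"
    using \<rho>le \<rho>0 by (intro integrable_on_bounded_continuous lmU \<rho>cS)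
      (auto simp: bounded_iff intro!: exI[of _ \<delta>])
  have McU: "continuous_on U M" and GcU: "continuous_on U G"
    using M Gc UB continuous_on_subset by blast+
  have jac_le: "\<bar>det (M y)\<bar> * (F (G y) * g (G y)) \<le> q * \<rho> y" if "y \<in> U" for y
  proof -
    have "\<rho> y * (\<bar>det (M y)\<bar> * g (G y)) \<le> \<rho> y * q"
      using that UB by (intro mult_left_mono q \<rho>0) auto
    then show ?thesis using that by (simp add: FG mult_ac)
  qed
  have int: "(\<lambda>y. \<bar>det (M y)\<bar> * (F (G y) * g (G y))) integrable_on U"
  proof (rule integrable_on_bounded_continuous[OF lmU])
    have "continuous_on U (\<lambda>y. \<bar>det (M y)\<bar> * (\<rho> y * g (G y)))"
      by (intro continuous_intros continuous_on_det McU \<rho>cS continuous_on_compose2[OF gU(1) GcU]) auto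
    then show "continuous_on U (\<lambda>y. \<bar>det (M y)\<bar> * (F (G y) * g (G y)))"
      by (rule continuous_on_eq) (simp add: FG)
    have "norm (\<bar>det (M y)\<bar> * (F (G y) * g (G y))) \<le> \<bar>q\<bar> * \<delta>" if "y \<in> U" for y
    proof -
      have "q * \<rho> y \<le> \<bar>q\<bar> * \<delta>" using \<rho>0[of y] \<rho>le[of y] by (intro mult_mono) auto
      then show ?thesis using jac_le[OF that] F0 gU by (simp add: abs_mult)
    qed
    then show "bounded ((\<lambda>y. \<bar>det (M y)\<bar> * (F (G y) * g (G y))) ` U)"
      by (auto simp: bounded_iff)
  qed
  define I where "I = integral U (\<lambda>y. \<bar>det (M y)\<bar> * (F (G y) * g (G y)))"
  have "((\<lambda>\<xi>. F \<xi> * g \<xi>) has_integral I) (G ` U)"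
  proof (rule change_of_variables_nonneg[OF openU _ injU])
    show "(G has_derivative (\<lambda>h. M y *v h)) (at y)" if "y \<in> U" for y using dG that UB by blast
    show "0 \<le> F (G y) * g (G y)" for y using F0 gU by simp
    show "((\<lambda>y. \<bar>det (M y)\<bar> * (F (G y) * g (G y))) has_integral I) U"
      unfolding I_def by (rule integrable_integral[OF int])
  qed
  then have FgI: "((\<lambda>\<xi>. F \<xi> * g \<xi>) has_integral I) UNIV"
    by (rule has_integral_on_superset) (auto simp: F_def)
  have I_le: "I \<le> q * integral U \<rho>"
  proof -
    have "I \<le> integral U (\<lambda>y. q * \<rho> y)" unfolding I_def
      using jac_le by (intro integral_le int integrable_on_mult_right int\<rho>) auto
    then show ?thesis by simp
  qed
  have pos: "0 < integral U \<rho>"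
  proof -
    have "\<forall>\<^sub>F y in at x. \<delta> / 2 < \<rho> y"
    proof (rule order_tendstoD(1))
      show "(\<rho> \<longlongrightarrow> \<rho> x) (at x)" using \<rho>c by (simp add: continuous_on_eq_continuous_at isContD)
      show "\<delta> / 2 < \<rho> x" using s \<delta> by (simp add: \<rho>_def kx)
    qed
    then obtain t where t: "t > 0" "\<And>y. y \<noteq> x \<Longrightarrow> dist y x < t \<Longrightarrow> \<delta> / 2 < \<rho> y"
      unfolding eventually_at by blast
    have tb: "\<delta> / 2 < \<rho> y" if "y \<in> ball x t" for y
      using t(2)[of y] that s \<delta> by (cases "y = x") (auto simp: \<rho>_def kx dist_commute)
    then have tU: "ball x t \<subseteq> U" using \<delta> by (force simp: U_def)
    have lb: "ball x t \<in> lmeasurable" by simp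
    have "0 < \<delta> / 2 * measure lebesgue (ball x t)" using \<delta> content_ball_pos[OF t(1), of x] by simp
    also have "\<dots> = integral (ball x t) (\<lambda>y. \<delta> / 2)"
      using integral_mult_right[of "ball x t" "\<delta> / 2" "\<lambda>x. 1"] lmeasure_integral[OF lb] by simp
    also have "\<dots> \<le> integral (ball x t) \<rho>"
      using tb[THEN less_imp_le] \<rho>le \<rho>0
      by (intro integral_le integrable_on_const lb integrable_on_bounded_continuous \<rho>cS)
        (auto simp: bounded_iff intro!: exI[of _ \<delta>])
    also have "\<dots> \<le> integral U \<rho>"
      using tU \<rho>le \<rho>0 by (intro integral_subset_le integrable_on_bounded_continuous lb int\<rho> \<rho>cS)
        (auto simp: bounded_iff intro!: exI[of _ \<delta>])
    finally show ?thesis .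
  qed

  note iO = integrable_on_compact_closure[OF \<Omega>_lmeasurable \<Omega>(2)]
  have "(\<rho> has_integral integral U \<rho>) \<Omega>"
    by (rule has_integral_on_superset[OF integrable_integral[OF int\<rho>] _ U\<Omega>])
       (use \<rho>0 in \<open>auto simp: U_def not_less intro: antisym\<close>)
  then have "integral \<Omega> \<rho> = integral U \<rho>" by blast
  then have 1: "integral \<Omega> v = integral \<Omega> w - integral U \<rho>"
    unfolding v_def by (simp add: integral_diff iO wK \<rho>cS)
  let ?d = "\<lambda>\<xi>. legendre ?K v \<xi> * g \<xi> - legendre ?K w \<xi> * g \<xi>"
  have intd: "?d integrable_on C"
    by (intro integrable_diff legendre_weight_integrable wK vK)
  have "integral C ?d \<le> I"
  proof (rule has_integral_le)
    show "((\<lambda>\<xi>. if \<xi> \<in> C then ?d \<xi> else 0) has_integral integral C ?d) UNIV"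
      using intd by (simp only: has_integral_restrict_UNIV integrable_integral)
    show "(if \<xi> \<in> C then ?d \<xi> else 0) \<le> F \<xi> * g \<xi>" for \<xi>
      using mult_right_mono[OF legendre_le[of \<xi>] gU(2)[of \<xi>]] F0[of \<xi>] gU(2)[of \<xi>]
      by (simp add: distrib_right)
  qed (rule FgI)
  moreover have "integral C ?d = integral C (\<lambda>\<xi>. legendre ?K v \<xi> * g \<xi>) - integral C (\<lambda>\<xi>. legendre ?K w \<xi> * g \<xi>)"
    by (intro integral_diff legendre_weight_integrable wK vK)
  ultimately have 2: "integral C (\<lambda>\<xi>. legendre ?K v \<xi> * g \<xi>) \<le> integral C (\<lambda>\<xi>. legendre ?K w \<xi> * g \<xi>) + I"
    by simp
  have "q * integral U \<rho> < 1 * integral U \<rho>" using q pos by (intro mult_strict_right_mono)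
  then have "kantorovich_dual \<Omega> C g v < kantorovich_dual \<Omega> C g w"
    using 1 2 I_le by (simp add: kantorovich_dual_def)
  then show ?thesis using vK by blast
qed

text \<open>
  The positive definite derivative is invertible, and it varies continuously, so the inverse
  function argument applies.
\<close>

lemma C1_locally_injective_ball:
  fixes G :: "real^'n::finite \<Rightarrow> real^'n" and M :: "real^'n \<Rightarrow> real^'n^'n"
  assumes r: "0 < r"
    and dG: "\<And>y. y \<in> ball x r \<Longrightarrow> (G has_derivative (\<lambda>h. M y *v h)) (at y)"
    and M: "continuous_on (ball x r) M"
    and pd: "\<And>u. u \<noteq> 0 \<Longrightarrow> 0 < u \<bullet> (M x *v u)"
  obtains s where "0 < s" "s \<le> r" "inj_on G (ball x s)"
proof -
  have "inj ((*v) (M x))"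
  proof (rule injI)
    fix u v assume "M x *v u = M x *v v"
    then have "(u - v) \<bullet> (M x *v (u - v)) = 0" by (simp add: matrix_vector_mult_diff_distrib)
    then show "u = v" using pd[of "u - v"] by auto
  qed
  then obtain B where B: "B ** M x = mat 1" using matrix_left_invertible_injective by blast
  have inv: "(*v) B \<circ> (*v) (M x) = id"
    by (simp add: fun_eq_iff matrix_vector_mul_assoc B)
  have on: "\<exists>d>0. \<forall>y. dist x y < d \<longrightarrow> onorm (\<lambda>v. M y *v v - M x *v v) < e" if e: "e > 0" for e
  proof -
    have xr: "x \<in> ball x r" using r by simp
    have "isCont M x" using M xr by (simp add: continuous_on_eq_continuous_at)
    then have "((\<lambda>y. M y $ i $ j) \<longlongrightarrow> M x $ i $ j) (at x)" for i j
      unfolding isCont_def by (intro tendsto_vec_nth)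
    then have "((\<lambda>y. \<Sum>i\<in>UNIV. \<Sum>j\<in>UNIV. \<bar>(M y - M x) $ i $ j\<bar>) \<longlongrightarrow> (\<Sum>i\<in>(UNIV::'n set). \<Sum>j\<in>(UNIV::'n set). 0)) (at x)"
      by (intro tendsto_sum) (simp add: tendsto_rabs_zero_iff LIM_zero_iff)
    then have "((\<lambda>y. \<Sum>i\<in>UNIV. \<Sum>j\<in>UNIV. \<bar>(M y - M x) $ i $ j\<bar>) \<longlongrightarrow> 0) (at x)" by simp
    then have "\<forall>\<^sub>F y in at x. (\<Sum>i\<in>UNIV. \<Sum>j\<in>UNIV. \<bar>(M y - M x) $ i $ j\<bar>) < e"
      using e by (rule order_tendstoD)
    then obtain d where d: "d > 0" "\<And>y. y \<noteq> x \<Longrightarrow> dist y x < d \<Longrightarrow> (\<Sum>i\<in>UNIV. \<Sum>j\<in>UNIV. \<bar>(M y - M x) $ i $ j\<bar>) < e"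
      unfolding eventually_at by blast
    have "onorm (\<lambda>v. M y *v v - M x *v v) < e" if "dist x y < d" for y
    proof (cases "y = x")
      case False
      have "onorm (\<lambda>v. M y *v v - M x *v v) = onorm ((*v) (M y - M x))"
        by (rule arg_cong[where f = onorm]) (simp add: fun_eq_iff matrix_vector_mult_diff_rdistrib)
      also have "\<dots> \<le> (\<Sum>i\<in>UNIV. \<Sum>j\<in>UNIV. \<bar>(M y - M x) $ i $ j\<bar>)"
        by (rule onorm_le_matrix_component_sum)
      also have "\<dots> < e" using d(2) False that by (simp add: dist_commute)
      finally show ?thesis .
    qed (simp add: onorm_zero e)
    with d(1) show ?thesis by blast
  qed
  have bl: "bounded_linear ((*v) B)" by simp
  obtain s where s: "s > 0" "ball x s \<subseteq> ball x r" "inj_on G (ball x s)"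
    by (rule has_derivative_locally_injective[OF _ open_ball bl inv dG on]) (use r in auto)
  show ?thesis
  proof (rule that[of "min s r"])
    show "inj_on G (ball x (min s r))" using s(3) by (rule inj_on_subset) auto
  qed (use s r in auto)
qed

text \<open>
  A viscosity form of the Monge-Ampere inequality for the minimiser. If it failed, then it would
  still fail, with a uniform factor \<open>q < 1\<close> on a small ball, for \<open>\<psi> + e/2 \<bar>y - x\<bar>\<^sup>2\<close> with a small
  \<open>e > 0\<close>. This added term makes the contact strict and the Hessian positive definite, hence the
  gradient injective, as the competitor requires.
\<close>

lemma minimizer_touching_jacobian:
  fixes \<Omega> C :: "(real^'n::finite) set" and M :: "real^'n \<Rightarrow> real^'n^'n"
  assumes bt: "balanced_transport \<Omega> C g"
    and gU: "continuous_on UNIV g" "\<And>\<xi>. 0 \<le> g \<xi>"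
    and h: "continuous_on C h"
    and min: "\<And>v. continuous_on (closure \<Omega>) v \<Longrightarrow>
       kantorovich_dual \<Omega> C g (legendre C h) \<le> kantorovich_dual \<Omega> C g v"
    and r: "0 < r" "ball x r \<subseteq> \<Omega>"
    and d\<psi>: "\<And>y. y \<in> ball x r \<Longrightarrow> (\<psi> has_derivative (\<lambda>h. G y \<bullet> h)) (at y)"
    and dG: "\<And>y. y \<in> ball x r \<Longrightarrow> (G has_derivative (\<lambda>h. M y *v h)) (at y)"
    and M: "continuous_on (ball x r) M"
    and touch: "\<And>y. y \<in> ball x r \<Longrightarrow> legendre C h y \<le> \<psi> y" "\<psi> x = legendre C h x"
  shows "0 \<le> u \<bullet> (M x *v u)" and "1 \<le> \<bar>det (M x)\<bar> * g (G x)"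
proof -
  interpret balanced_transport \<Omega> C g by (rule bt)
  let ?w = "legendre C h"
  have xr: "x \<in> ball x r" using r by simp
  obtain \<xi> where \<xi>: "\<xi> \<in> C" "?w x = x \<bullet> \<xi> - h \<xi>"
    by (rule legendre_attained[OF C h, of x]) blast
  have psd: "0 \<le> u \<bullet> (M x *v u)" for u
  proof (rule hessian_psd_at_affine_support[OF r(1) d\<psi> dG[OF xr]])
    fix y assume y: "y \<in> ball x r"
    have "y \<bullet> \<xi> - h \<xi> \<le> ?w y" by (rule legendre_ge[OF C h \<xi>(1)])
    then show "\<psi> x + \<xi> \<bullet> (y - x) \<le> \<psi> y"
      using touch(1)[OF y] touch(2) \<xi>(2) by (simp add: inner_diff_right inner_commute)
  qed
  then show "0 \<le> u \<bullet> (M x *v u)" .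
  show "1 \<le> \<bar>det (M x)\<bar> * g (G x)"
  proof (rule ccontr)
    assume "\<not> ?thesis"
    then have lt: "\<bar>det (M x)\<bar> * g (G x) < 1" by simp
    have "continuous_on UNIV (\<lambda>e. \<bar>det (M x + e *\<^sub>R mat 1)\<bar> * g (G x))"
      by (intro continuous_intros continuous_on_det)
    then have "((\<lambda>e. \<bar>det (M x + e *\<^sub>R mat 1)\<bar> * g (G x)) \<longlongrightarrow> \<bar>det (M x + 0 *\<^sub>R mat 1)\<bar> * g (G x)) (at_right 0)"
      by (meson continuous_on_def UNIV_I tendsto_within_subset subset_UNIV)
    then have "\<forall>\<^sub>F e in at_right 0. \<bar>det (M x + e *\<^sub>R mat 1)\<bar> * g (G x) < 1"
      by (rule order_tendstoD) (use lt in simp)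
    moreover have "\<forall>\<^sub>F e in at_right 0. (0::real) < e" by (simp add: eventually_at_right_less)
    ultimately have "\<forall>\<^sub>F e in at_right 0. 0 < e \<and> \<bar>det (M x + e *\<^sub>R mat 1)\<bar> * g (G x) < 1"
      by eventually_elim auto
    then obtain e where e: "0 < e" and elt: "\<bar>det (M x + e *\<^sub>R mat 1)\<bar> * g (G x) < 1"
      using eventually_happens'[OF trivial_limit_at_right_real] by blast
    define \<psi>' where "\<psi>' y = \<psi> y + e / 2 * ((y - x) \<bullet> (y - x))" for y
    define G' where "G' y = G y + e *\<^sub>R (y - x)" for y
    define M' where "M' y = M y + e *\<^sub>R mat 1" for y
    have d\<psi>': "(\<psi>' has_derivative (\<lambda>h. G' y \<bullet> h)) (at y)" if "y \<in> ball x r" for y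
      unfolding \<psi>'_def G'_def
      by (auto intro!: derivative_eq_intros d\<psi>[OF that] simp: fun_eq_iff inner_add_left inner_commute algebra_simps)
    have dG': "(G' has_derivative (\<lambda>h. M' y *v h)) (at y)" if "y \<in> ball x r" for y
      unfolding G'_def M'_def
      by (auto intro!: derivative_eq_intros dG[OF that]
          simp: fun_eq_iff matrix_vector_mult_add_rdistrib scaleR_matrix_vector_assoc[symmetric])
    have M': "continuous_on (ball x r) M'" unfolding M'_def by (intro continuous_intros M)
    have pd: "0 < u \<bullet> (M' x *v u)" if "u \<noteq> 0" for u
      using psd[of u] e that
      by (simp add: M'_def matrix_vector_mult_add_rdistrib scaleR_matrix_vector_assoc[symmetric] inner_add_right add_nonneg_pos)
    obtain s1 where s1: "0 < s1" "s1 \<le> r" "inj_on G' (ball x s1)"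
      by (rule C1_locally_injective_ball[OF r(1) dG' M' pd])
    define q where "q = (\<bar>det (M' x)\<bar> * g (G' x) + 1) / 2"
    have G'x: "G' x = G x" by (simp add: G'_def)
    have "\<bar>det (M' x)\<bar> * g (G' x) < 1" using elt by (simp only: G'x M'_def)
    then have q: "q < 1" "\<bar>det (M' x)\<bar> * g (G' x) < q" by (simp_all add: q_def mult.commute)
    have Gc: "continuous_on (ball x r) G'"
      by (intro continuous_at_imp_continuous_on ballI has_derivative_continuous[OF dG'])
    have "continuous_on (ball x r) (\<lambda>y. \<bar>det (M' y)\<bar> * g (G' y))"
      by (intro continuous_intros continuous_on_det M' continuous_on_compose2[OF gU(1) Gc]) auto
    then have "isCont (\<lambda>y. \<bar>det (M' y)\<bar> * g (G' y)) x"
      using xr by (simp add: continuous_on_eq_continuous_at)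
    then have "\<forall>\<^sub>F y in at x. \<bar>det (M' y)\<bar> * g (G' y) < q"
      unfolding isCont_def by (rule order_tendstoD) (rule q)
    then obtain s2 where s2: "0 < s2" "\<And>y. y \<noteq> x \<Longrightarrow> dist y x < s2 \<Longrightarrow> \<bar>det (M' y)\<bar> * g (G' y) < q"
      unfolding eventually_at by blast
    define s where "s = min s1 s2"
    have s: "0 < s" "s \<le> s1" "s \<le> s2" "ball x s \<subseteq> ball x r" using s1 s2 by (auto simp: s_def)
    have "\<exists>v. continuous_on (closure \<Omega>) v \<and> kantorovich_dual \<Omega> C g v < kantorovich_dual \<Omega> C g ?w"
    proof (rule transport_competitor[OF bt gU _ s(1) _ d\<psi>' dG' _ _ q(1)])
      show "continuous_on UNIV ?w" by (rule continuous_on_legendre[OF C h])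
      show "ball x s \<subseteq> \<Omega>" using s r by blast
      show "continuous_on (ball x s) M'" using M' s(4) continuous_on_subset by blast
      show "inj_on G' (ball x s)" using s1(3) by (rule inj_on_subset) (use s in auto)
      show "\<bar>det (M' y)\<bar> * g (G' y) \<le> q" if "y \<in> ball x s" for y
        using s2(2)[of y] q(2) that s by (cases "y = x") (auto simp: dist_commute)
      show "0 < e / 2" using e by simp
      show "?w y + e / 2 * (norm (y - x))\<^sup>2 \<le> \<psi>' y" if "y \<in> ball x s" for y
        using touch(1)[of y] that s(4) by (auto simp: \<psi>'_def power2_norm_eq_inner)
      show "\<psi>' x = ?w x" by (simp add: \<psi>'_def touch)
    qed (use s(4) in auto)
    then show False using min by (meson not_less)
  qed
qed

section \<open>Mass of the target density\<close>

lemma nn_integral_Gamma_scaled: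
  assumes b: "0 < b" and c: "0 < (c::real)"
  shows "(\<integral>\<^sup>+s. ennreal (indicator {0..} s * s powr (b - 1) / exp (c * s)) \<partial>lborel) = ennreal (Gamma b / c powr b)"
proof -
  have "ennreal (Gamma b) = (\<integral>\<^sup>+t. ennreal (indicator {0..} t * t powr (b - 1) / exp t) \<partial>lborel)"
    by (rule Gamma_conv_nn_integral_real[OF b])
  also have "\<dots> = ennreal c * (\<integral>\<^sup>+s. ennreal (indicator {0..} (0 + c * s) * (0 + c * s) powr (b - 1) / exp (0 + c * s)) \<partial>lborel)"
    using nn_integral_real_affine[of "\<lambda>t. ennreal (indicator {0..} t * t powr (b - 1) / exp t)" c 0] c by simp
  also have "(\<lambda>s. ennreal (indicator {0..} (0 + c * s) * (0 + c * s) powr (b - 1) / exp (0 + c * s)))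
     = (\<lambda>s. ennreal (c powr (b - 1)) * ennreal (indicator {0..} s * s powr (b - 1) / exp (c * s)))"
    using c by (auto simp: fun_eq_iff indicator_def zero_le_mult_iff powr_mult ennreal_mult''[symmetric])
  also have "(\<integral>\<^sup>+s. ennreal (c powr (b - 1)) * ennreal (indicator {0..} s * s powr (b - 1) / exp (c * s)) \<partial>lborel)
     = ennreal (c powr (b - 1)) * (\<integral>\<^sup>+s. ennreal (indicator {0..} s * s powr (b - 1) / exp (c * s)) \<partial>lborel)"
    by (rule nn_integral_cmult) measurable
  finally have *: "ennreal (Gamma b) = ennreal (c powr b) * (\<integral>\<^sup>+s. ennreal (indicator {0..} s * s powr (b - 1) / exp (c * s)) \<partial>lborel)"
    using c by (simp add: mult.assoc[symmetric] ennreal_mult''[symmetric] powr_diff)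
  have "ennreal (Gamma b / c powr b) = ennreal (1 / c powr b) * ennreal (Gamma b)"
    using b by (simp add: ennreal_mult''[symmetric] Gamma_real_pos less_imp_le)
  also have "\<dots> = (\<integral>\<^sup>+s. ennreal (indicator {0..} s * s powr (b - 1) / exp (c * s)) \<partial>lborel)"
    unfolding * using c by (simp add: mult.assoc[symmetric] ennreal_mult''[symmetric])
  finally show ?thesis by simp
qed

lemma nn_integral_gaussian_real:
  assumes k: "0 < (k::real)"
  shows "(\<integral>\<^sup>+x. ennreal (exp (- (k * x\<^sup>2))) \<partial>lborel) = ennreal (sqrt (pi / k))"
proof -
  define \<sigma> where "\<sigma> = sqrt (1 / (2 * k))"
  have \<sigma>: "\<sigma> > 0" "2 * \<sigma>\<^sup>2 = 1 / k" using k by (simp_all add: \<sigma>_def)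
  have eq: "exp (- (k * x\<^sup>2)) = sqrt (pi / k) * normal_density 0 \<sigma> x" for x
  proof -
    have "2 * pi * \<sigma>\<^sup>2 = pi / k" using \<sigma>(2) by (simp add: field_simps)
    moreover have "- (x - 0)\<^sup>2 / (2 * \<sigma>\<^sup>2) = - (k * x\<^sup>2)" using \<sigma>(2) by simp
    ultimately show ?thesis using k by (simp add: normal_density_def)
  qed
  have "(\<integral>\<^sup>+x. ennreal (normal_density 0 \<sigma> x) \<partial>lborel) = 1"
    using \<sigma> by (subst nn_integral_eq_integral) (auto simp: integrable_normal_density)
  then show ?thesis using k
    by (simp add: eq ennreal_mult nn_integral_cmult)
qed

lemma nn_integral_gaussian:
  assumes k: "0 < k"
  shows "(\<integral>\<^sup>+x. ennreal (exp (- (k * (norm x)\<^sup>2))) \<partial>(lborel :: 'a::euclidean_space measure))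
     = ennreal ((pi / k) powr (DIM('a) / 2))"
proof -
  have "ennreal (exp (- (k * (norm x)\<^sup>2))) = (\<Prod>b\<in>Basis. ennreal (exp (- (k * (x \<bullet> b)\<^sup>2))))" for x :: 'a
  proof -
    have "(norm x)\<^sup>2 = (\<Sum>b\<in>Basis. (x \<bullet> b)\<^sup>2)"
      proof -
      have "(norm x)\<^sup>2 = x \<bullet> x" by (rule power2_norm_eq_inner)
      also have "\<dots> = (\<Sum>b\<in>Basis. (x \<bullet> b)\<^sup>2)" by (simp only: euclidean_inner[of x x] power2_eq_square)
      finally show ?thesis .
    qed
    then have "exp (- (k * (norm x)\<^sup>2)) = (\<Prod>b\<in>Basis. exp (- (k * (x \<bullet> b)\<^sup>2)))"
      by (simp add: sum_distrib_left exp_sum flip: sum_negf)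
    then show ?thesis by (simp add: prod_ennreal)
  qed
  then have "(\<integral>\<^sup>+x. ennreal (exp (- (k * (norm x)\<^sup>2))) \<partial>(lborel :: 'a measure))
     = (\<Prod>b\<in>(Basis::'a set). \<integral>\<^sup>+x. ennreal (exp (- (k * x\<^sup>2))) \<partial>lborel)"
    using nn_integral_lborel_prod[of "\<lambda>(b::'a) x. ennreal (exp (- (k * x\<^sup>2)))"] by simp
  also have "\<dots> = ennreal (sqrt (pi / k) ^ DIM('a))"
    using k by (simp add: nn_integral_gaussian_real ennreal_power)
  also have "sqrt (pi / k) ^ DIM('a) = (pi / k) powr (DIM('a) / 2)"
    using k by (simp add: powr_half_sqrt[symmetric] powr_realpow[symmetric] powr_powr)
  finally show ?thesis .
qed

text \<open>
  Writing \<open>Gamma n / q\<^sup>n\<close> as \<open>\<integral> s\<^sup>n\<^sup>-\<^sup>1 exp (- q s) ds\<close> and exchanging the integrals leaves a Gaussian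
  integral in \<open>x\<close>, followed by a second Gamma integral with exponent \<open>n / 2\<close>.
\<close>

proposition nn_integral_inverse_quadratic_power:
  fixes a l :: real
  assumes a: "0 < a" and l: "0 < l"
  shows "(\<integral>\<^sup>+x. ennreal (1 / (l + a * (norm x)\<^sup>2) ^ DIM('a)) \<partial>(lborel :: 'a::euclidean_space measure))
     = ennreal ((pi / (a * l)) powr (DIM('a) / 2) * Gamma (DIM('a) / 2) / Gamma (DIM('a)))"
proof -
  define n where "n = real DIM('a)"
  have n: "n > 0" by (simp add: n_def)
  define q where "q x = l + a * (norm x)\<^sup>2" for x :: 'a
  have q: "q x > 0" for x using a l by (simp add: q_def add_pos_nonneg)
  define f where "f x s = ennreal (indicator {0..} s * s powr (n - 1) / exp (q x * s))" for x s
  have Gn: "Gamma n > 0" using n by (rule Gamma_real_pos)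
  have meas: "case_prod f \<in> borel_measurable (lborel \<Otimes>\<^sub>M lborel)"
    unfolding f_def q_def by measurable
  have "ennreal (Gamma n) * (\<integral>\<^sup>+x. ennreal (1 / q x ^ DIM('a)) \<partial>lborel) = (\<integral>\<^sup>+x. ennreal (Gamma n) * ennreal (1 / q x ^ DIM('a)) \<partial>lborel)"
    unfolding q_def by (rule nn_integral_cmult[symmetric]) measurable
  also have "\<dots> = (\<integral>\<^sup>+x. (\<integral>\<^sup>+s. f x s \<partial>lborel) \<partial>lborel)"
  proof (rule nn_integral_cong)
    fix x
    have "(\<integral>\<^sup>+s. f x s \<partial>lborel) = ennreal (Gamma n / q x powr n)"
      unfolding f_def by (rule nn_integral_Gamma_scaled[OF n q])
    also have "q x powr n = q x ^ DIM('a)" using q by (simp add: n_def powr_realpow)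
    finally show "ennreal (Gamma n) * ennreal (1 / q x ^ DIM('a)) = (\<integral>\<^sup>+s. f x s \<partial>lborel)"
      using Gn q[of x] by (simp add: ennreal_mult[symmetric] less_imp_le)
  qed
  also have "\<dots> = (\<integral>\<^sup>+s. (\<integral>\<^sup>+x. f x s \<partial>lborel) \<partial>lborel)"
    by (rule lborel_pair.Fubini'[symmetric]) (rule meas)
  also have "\<dots> = (\<integral>\<^sup>+s. ennreal ((pi / a) powr (n / 2)) * ennreal (indicator {0..} s * s powr (n / 2 - 1) / exp (l * s)) \<partial>lborel)"
  proof (rule nn_integral_cong)
    fix s :: real
    show "(\<integral>\<^sup>+x. f x s \<partial>lborel) = ennreal ((pi / a) powr (n / 2)) * ennreal (indicator {0..} s * s powr (n / 2 - 1) / exp (l * s))"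
    proof (cases "s > 0")
      \<comment> \<open>at \<open>s = 0\<close> both sides vanish because \<open>0 powr _ = 0\<close>\<close>
      case False
      then have "s < 0 \<or> s = 0" by auto
      then show ?thesis by (auto simp: f_def)
    next
      case True
      have "f x s = ennreal (s powr (n - 1) / exp (l * s)) * ennreal (exp (- (a * s * (norm x)\<^sup>2)))" for x
        using True by (simp add: f_def q_def ennreal_mult[symmetric] exp_minus exp_add[symmetric] field_simps)
      then have "(\<integral>\<^sup>+x. f x s \<partial>lborel) = (\<integral>\<^sup>+x. ennreal (s powr (n - 1) / exp (l * s)) * ennreal (exp (- (a * s * (norm (x::'a))\<^sup>2))) \<partial>lborel)"
        by simp
      also have "\<dots> = ennreal (s powr (n - 1) / exp (l * s)) * (\<integral>\<^sup>+x. ennreal (exp (- (a * s * (norm (x::'a))\<^sup>2))) \<partial>lborel)"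
        by (rule nn_integral_cmult) measurable
      also have "\<dots> = ennreal (s powr (n - 1) / exp (l * s)) * ennreal ((pi / (a * s)) powr (n / 2))"
        using nn_integral_gaussian[of "a * s", where 'a = 'a] a True by (simp add: n_def)
      also have "\<dots> = ennreal (s powr (n - 1) / exp (l * s) * (pi / (a * s)) powr (n / 2))"
        by (rule ennreal_mult[symmetric]) auto
      also have "s powr (n - 1) / exp (l * s) * (pi / (a * s)) powr (n / 2)
         = (pi / a) powr (n / 2) * (s powr (n / 2 - 1) / exp (l * s))"
      proof -
        have "(pi / (a * s)) powr (n / 2) = (pi / a) powr (n / 2) * s powr (- (n / 2))"
          using a True by (simp add: powr_divide powr_mult powr_minus field_simps)
        moreover have "s powr (n - 1) * s powr (- (n / 2)) = s powr (n / 2 - 1)"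
          by (simp add: powr_add[symmetric])
        ultimately show ?thesis by (simp add: mult.commute mult.left_commute)
      qed
      also have "ennreal ((pi / a) powr (n / 2) * (s powr (n / 2 - 1) / exp (l * s)))
        = ennreal ((pi / a) powr (n / 2)) * ennreal (s powr (n / 2 - 1) / exp (l * s))"
        by (rule ennreal_mult) auto
      finally show ?thesis using True by simp
    qed
  qed
  also have "\<dots> = ennreal ((pi / a) powr (n / 2)) * (\<integral>\<^sup>+s. ennreal (indicator {0..} s * s powr (n / 2 - 1) / exp (l * s)) \<partial>lborel)"
    by (rule nn_integral_cmult) measurable
  also have "\<dots> = ennreal ((pi / a) powr (n / 2)) * ennreal (Gamma (n / 2) / l powr (n / 2))"
    using n l by (simp add: nn_integral_Gamma_scaled)
  also have "\<dots> = ennreal ((pi / (a * l)) powr (n / 2) * Gamma (n / 2))"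
    using n l a by (simp add: ennreal_mult[symmetric] Gamma_real_pos less_imp_le powr_divide powr_mult)
  finally have *: "ennreal (Gamma n) * (\<integral>\<^sup>+x. ennreal (1 / q x ^ DIM('a)) \<partial>lborel) = ennreal ((pi / (a * l)) powr (n / 2) * Gamma (n / 2))" .
  have "(\<integral>\<^sup>+x. ennreal (1 / q x ^ DIM('a)) \<partial>lborel) = ennreal (1 / Gamma n) * (ennreal (Gamma n) * (\<integral>\<^sup>+x. ennreal (1 / q x ^ DIM('a)) \<partial>lborel))"
    using Gn by (simp add: mult.assoc[symmetric] ennreal_mult''[symmetric])
  also have "\<dots> = ennreal ((pi / (a * l)) powr (n / 2) * Gamma (n / 2) / Gamma n)"
    unfolding * using Gn n by (simp add: ennreal_mult''[symmetric] Gamma_real_pos less_imp_le)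
  finally show ?thesis by (simp add: q_def n_def)
qed

lemma Gamma_duplication_half:
  assumes n: "0 < (n::real)"
  shows "Gamma (n / 2) * Gamma ((n + 1) / 2) = 2 powr (1 - n) * sqrt pi * Gamma n"
proof -
  have "complex_of_real (n / 2) \<notin> \<int>\<^sub>\<le>\<^sub>0" "complex_of_real (n / 2) + 1 / 2 \<notin> \<int>\<^sub>\<le>\<^sub>0"
    using n by (auto elim!: nonpos_Ints_cases simp: complex_eq_iff)
  from Gamma_legendre_duplication[OF this]
  have "complex_of_real (Gamma (n / 2) * Gamma ((n + 1) / 2)) = complex_of_real (exp ((1 - n) * ln 2) * sqrt pi * Gamma n)"
    by (simp add: Gamma_complex_of_real[symmetric] exp_of_real[symmetric] add_divide_distrib)
  then have "Gamma (n / 2) * Gamma ((n + 1) / 2) = exp ((1 - n) * ln 2) * sqrt pi * Gamma n"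
    by (simp only: of_real_eq_iff)
  then show ?thesis by (simp add: powr_def)
qed

lemma K_const_pos: "1 < p \<Longrightarrow> 0 < n \<Longrightarrow> 0 < K_const n p"
  using less_imp_neq[OF Gamma_real_pos[of "(real n + 1) / 2"]] unfolding K_const_def
  by (intro mult_pos_pos divide_pos_pos zero_less_power) auto

text \<open>
  The right-hand side is the total mass of the target density for \<open>l = 1\<close>. Both sides are compared
  after taking logarithms; apart from the duplication formula, which trades \<open>Gamma (n/2) / Gamma n\<close>
  for \<open>Gamma ((n + 1)/2)\<close>, the only inequality used is \<open>n ln (min (p - 1) 1) \<le> ln (p - 1)\<close>.
\<close>

lemma K_const_powr_le:
  fixes p :: real and n :: nat
  assumes p: "1 < p" and n: "0 < n"
  shows "K_const n p powr (n / 2) \<le>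
    real n ^ n * (p - 1) / p ^ n * ((pi / ((p - 1) / p)) powr (n / 2) * Gamma (n / 2) / Gamma n)"
proof -
  define N where "N = real n"
  define m where "m = min (p - 1) 1"
  have N: "N > 0" using n by (simp add: N_def)
  have N1: "N \<ge> 1" using n by (simp add: N_def)
  have m: "m > 0" using p by (simp add: m_def)
  have G: "Gamma ((N + 1) / 2) > 0" "Gamma (N / 2) > 0" "Gamma N > 0" using N by (auto intro: Gamma_real_pos)
  have dup: "ln (Gamma (N / 2)) + ln (Gamma ((N + 1) / 2)) = (1 - N) * ln 2 + ln pi / 2 + ln (Gamma N)"
  proof -
    have "ln (Gamma (N / 2) * Gamma ((N + 1) / 2)) = ln (2 powr (1 - N) * sqrt pi * Gamma N)"
      by (simp add: Gamma_duplication_half[OF N])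
    then show ?thesis using G by (simp add: ln_mult ln_powr ln_sqrt)
  qed
  have mN: "N * ln m \<le> ln (p - 1)"
  proof (cases "p \<le> 2")
    case True
    then have "ln (p - 1) \<le> 0" "m = p - 1" using p by (auto simp: m_def)
    then show ?thesis using N1 mult_right_mono_neg[of 1 N "ln (p - 1)"] by simp
  next
    case False
    then have "m = 1" "0 \<le> ln (p - 1)" by (auto simp: m_def)
    then show ?thesis by simp
  qed
  have ln4: "ln (4::real) = 2 * ln 2"
    using ln_realpow[of 2 2] by simp
  let ?K = "K_const n p"
  let ?R = "N powr N * (p - 1) / p powr N * ((pi / ((p - 1) / p)) powr (N / 2) * Gamma (N / 2) / Gamma N)"
  have lnK: "ln ?K = 2 * ln N + 2 * ln m - ln p - ln (p - 1) + (- 1 + 1 / N) * (2 * ln 2) + (1 + 1 / N) * ln pi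
      - 2 / N * ln (Gamma ((N + 1) / 2))"
    using N m p G less_imp_neq[OF G(1)]
    by (simp add: K_const_def N_def[symmetric] m_def[symmetric] ln_mult ln_div ln_powr ln4 ln_realpow)
  have lnR: "ln ?R = N * ln N + ln (p - 1) - N * ln p + (N / 2) * (ln pi - (ln (p - 1) - ln p))
       + ln (Gamma (N / 2)) - ln (Gamma N)"
    using N p G less_imp_neq[OF G(2)] less_imp_neq[OF G(3)] by (simp add: ln_mult ln_div ln_powr)
  have "ln (?K powr (N / 2)) = N / 2 * ln ?K" using K_const_pos[OF p n] by (simp add: ln_powr)
  also have "\<dots> = N * ln N + N * ln m - N / 2 * ln p - N / 2 * ln (p - 1) + (1 - N) * ln 2 + (N + 1) / 2 * ln pi
      - ln (Gamma ((N + 1) / 2))"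
    unfolding lnK using N by (simp add: field_simps)
  also have "\<dots> \<le> ln ?R" unfolding lnR using dup mN by (simp add: field_simps)
  finally have le: "ln (?K powr (N / 2)) \<le> ln ?R" .
  have "?K powr (N / 2) > 0" using K_const_pos[OF p n] by simp
  moreover have "?R > 0" using N p G by simp
  ultimately have "?K powr (N / 2) \<le> ?R" using le by (rule iffD1[OF ln_le_cancel_iff])
  then show ?thesis using n p by (simp add: N_def powr_realpow)
qed

lemma cball_integral_exceeds:
  fixes g :: "'a::euclidean_space \<Rightarrow> real"
  assumes g: "continuous_on UNIV g" "\<And>x. 0 \<le> g x" and V: "0 \<le> V"
    and less: "ennreal V < (\<integral>\<^sup>+x. ennreal (g x) \<partial>lborel)"
  obtains k :: nat where "V < integral (cball 0 (real k)) g"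
proof -
  define f where "f k x = ennreal (g x) * indicator (cball 0 (real k)) x" for k :: nat and x
  have [measurable]: "g \<in> borel_measurable borel" by (rule borel_measurable_continuous_onI[OF g(1)])
  have mono: "incseq f"
    unfolding f_def incseq_def le_fun_def
    by (intro allI impI mult_left_mono) (auto simp: indicator_def)
  have sup: "(SUP k. f k x) = ennreal (g x)" for x
  proof (rule antisym)
    show "(SUP k. f k x) \<le> ennreal (g x)" by (rule SUP_least) (auto simp: f_def indicator_def)
    obtain k :: nat where "norm x \<le> real k" using real_arch_simple by blast
    then have "ennreal (g x) = f k x" by (simp add: f_def)
    then show "ennreal (g x) \<le> (SUP k. f k x)" by (metis SUP_upper UNIV_I)
  qed
  have [measurable]: "cball (0::'a) (real k) \<in> sets borel" for k by (simp add: borel_closed)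
  have fmeas: "f k \<in> borel_measurable lborel" for k unfolding f_def by measurable
  have "(\<integral>\<^sup>+x. ennreal (g x) \<partial>lborel) = (SUP k. integral\<^sup>N lborel (f k))"
    using nn_integral_monotone_convergence_SUP[OF mono fmeas] by (simp add: sup)
  then obtain k where k: "ennreal V < integral\<^sup>N lborel (f k)"
    using less by (auto simp: less_SUP_iff)
  have "g integrable_on cball 0 (real k)"
    by (rule integrable_on_compact_closure)
      (use g(1) continuous_on_subset in auto)
  then have "integral\<^sup>N lborel (f k) = ennreal (integral (cball 0 (real k)) g)"
    unfolding f_def using g(2)
    by (intro nn_integral_has_integral_lebesgue') (auto simp: integrable_integral)
  with k V show ?thesis using that by (simp add: ennreal_less_iff)
qed

section \<open>Supersolutions\<close>

text \<open>
  The Monge-Ampere inequality \<open>jac\<close> and the anisotropic inequality for \<open>det M\<close>, with \<open>a = p - 1\<close>,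
  bound the \<open>n\<close>-th power of the left-hand side by that of the right-hand side.
\<close>

lemma minimizer_contact_inequality:
  fixes M :: "real^'n::finite^'n" and \<xi> e :: "real^'n" and p l :: real
  assumes p: "1 < p" and l: "0 < l" and \<theta>: "\<theta> \<le> 1"
    and sym: "transpose M = M" and psd: "\<And>u. 0 \<le> u \<bullet> (M *v u)"
    and jac: "1 \<le> \<bar>det M\<bar> * (\<theta> * (real CARD('n) ^ CARD('n) * (p - 1) / p ^ CARD('n)
                 / (l + (p - 1) / p * (norm \<xi>)\<^sup>2) ^ CARD('n)))"
    and e: "norm e = 1"
  shows "l + (p - 1) / p * (norm \<xi>)\<^sup>2 \<le> (trace M + (p - 2) * (e \<bullet> (M *v e))) / p"
proof -
  let ?n = "CARD('n)"
  define q where "q = l + (p - 1) / p * (norm \<xi>)\<^sup>2"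
  define T where "T = trace M + (p - 2) * (e \<bullet> (M *v e))"
  have q: "q > 0" using l p by (simp add: q_def add_pos_nonneg)
  have d0: "0 \<le> det M" by (rule det_le_trace_power_psd(1)[OF sym psd])
  have T: "0 \<le> T" "(p - 1) * det M \<le> (T / ?n) ^ ?n"
    using det_le_anisotropic_trace_power[OF sym psd e, of "p - 1"] p by (simp_all add: T_def)
  have "1 \<le> det M * (\<theta> * (real ?n ^ ?n * (p - 1) / p ^ ?n / q ^ ?n))"
    using jac d0 by (simp add: q_def)
  also have "\<dots> = \<theta> * (det M * (real ?n ^ ?n * (p - 1) / p ^ ?n / q ^ ?n))" by simp
  also have "\<dots> \<le> 1 * (det M * (real ?n ^ ?n * (p - 1) / p ^ ?n / q ^ ?n))"
    using \<theta> d0 p q by (intro mult_right_mono) auto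
  finally have "1 \<le> (((p - 1) * det M) * real ?n ^ ?n / p ^ ?n) / q ^ ?n"
    by (simp add: mult_ac)
  then have "q ^ ?n \<le> ((p - 1) * det M) * real ?n ^ ?n / p ^ ?n"
    using q by (simp only: pos_le_divide_eq zero_less_power mult_1)
  also have "\<dots> \<le> (T / ?n) ^ ?n * real ?n ^ ?n / p ^ ?n"
    using T p by (intro divide_right_mono mult_right_mono) auto
  also have "\<dots> = (T / p) ^ ?n" by (simp add: power_divide)
  finally have "q ^ ?n \<le> (T / p) ^ ?n" .
  then have "q \<le> T / p"
    using q T p power_mono_iff[of q "T / p" ?n] by simp
  then show ?thesis by (simp add: q_def T_def)
qed

lemma trace_outer_square_diff:
  fixes H :: "real^'n::finite^'n"
  shows "trace (outer_square \<xi> - c *\<^sub>R H) = (norm \<xi>)\<^sup>2 - c * trace H"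
proof -
  have "trace (outer_square \<xi>) = (norm \<xi>)\<^sup>2"
    by (simp add: trace_def outer_square_def power2_norm_eq_inner inner_vec_def)
  moreover have "trace (c *\<^sub>R H) = c * trace H" by (simp add: trace_def sum_distrib_left)
  ultimately show ?thesis by (simp add: trace_sub)
qed

text \<open>
  Translates the inequality for \<open>D\<^sup>2(- ln \<phi>)\<close> back to the Hessian \<open>H\<close> of \<open>\<phi>\<close>, where \<open>f\<close> is the value
  of \<open>\<phi>\<close> and \<open>\<xi>\<close> the gradient of \<open>- ln \<phi>\<close>. The condition on \<open>e\<close> says that \<open>e\<close> is parallel to \<open>\<xi>\<close>
  or \<open>\<xi> = 0\<close>; it makes the first-order terms cancel exactly.
\<close>

lemma log_hessian_inequality:
  fixes H :: "real^'n::finite^'n" and \<xi> e :: "real^'n" and p l f :: real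
  assumes p: "1 < p" and f: "0 < f"
    and le: "l + (p - 1) / p * (norm \<xi>)\<^sup>2 \<le>
       (trace (outer_square \<xi> - (1 / f) *\<^sub>R H) + (p - 2) * (e \<bullet> ((outer_square \<xi> - (1 / f) *\<^sub>R H) *v e))) / p"
    and \<xi>e: "(\<xi> \<bullet> e)\<^sup>2 = (norm \<xi>)\<^sup>2"
  shows "l * f \<le> - (1 / p) * trace H - (p - 2) / p * (e \<bullet> (H *v e))"
proof -
  have "e \<bullet> ((outer_square \<xi> - (1 / f) *\<^sub>R H) *v e) = (norm \<xi>)\<^sup>2 - (1 / f) * (e \<bullet> (H *v e))"
    by (simp add: matrix_vector_mult_diff_rdistrib outer_square_mult_vec inner_diff_right
      scaleR_matrix_vector_assoc[symmetric] inner_commute \<xi>e[unfolded power2_eq_square] power2_eq_square)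
  then have "l + (p - 1) / p * (norm \<xi>)\<^sup>2 \<le>
       ((norm \<xi>)\<^sup>2 - (1 / f) * trace H + (p - 2) * ((norm \<xi>)\<^sup>2 - (1 / f) * (e \<bullet> (H *v e)))) / p"
    using le by (simp only: trace_outer_square_diff)
  also have "\<dots> = (p - 1) / p * (norm \<xi>)\<^sup>2 + (1 / f) * (- (1 / p) * trace H - (p - 2) / p * (e \<bullet> (H *v e)))"
    using p f by (simp add: field_simps)
  finally have "l \<le> (1 / f) * (- (1 / p) * trace H - (p - 2) / p * (e \<bullet> (H *v e)))" by simp
  then show ?thesis using f by (simp add: field_simps)
qed

lemma real_eigenvalue_unit_vector:
  assumes "m \<in> real_eigenvalues (A :: real^'n::finite^'n)"
  obtains e where "norm e = 1" "e \<bullet> (A *v e) = m"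
proof -
  obtain v where v: "v \<noteq> 0" "A *v v = m *\<^sub>R v" using assms by (auto simp: real_eigenvalues_def)
  let ?e = "(1 / norm v) *\<^sub>R v"
  have "norm ?e = 1" using v by simp
  moreover from this have "?e \<bullet> (A *v ?e) = m"
    by (simp only: matrix_vector_mult_scaleR v(2) scaleR_left_commute[of _ m] inner_scaleR_right norm_eq_1)
  ultimately show ?thesis using that by blast
qed

lemma measure_bounded_open_pos:
  fixes S :: "'a::euclidean_space set"
  assumes "open S" "bounded S" "S \<noteq> {}"
  shows "0 < measure lebesgue S"
proof -
  obtain x r where r: "r > 0" "ball x r \<subseteq> S" using assms openE by blast
  have "S \<in> lmeasurable" using assms by (simp add: bounded_set_imp_lmeasurable borel_open)
  then have "measure lebesgue (ball x r) \<le> measure lebesgue S"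
    using r by (intro measure_mono_fmeasurable) auto
  moreover have "measure lebesgue (ball x r) > 0"
    using content_ball_pos[OF r(1), of x] by simp
  ultimately show ?thesis by linarith
qed

text \<open>
  The bound on \<open>l\<close> says that the density \<open>g0\<close> has more mass than \<open>\<Omega>\<close>, so that a ball \<open>C\<close> and a factor
  \<open>\<theta> \<le> 1\<close> exist for which \<open>\<theta> g0\<close> on \<open>C\<close> is balanced against \<open>\<Omega>\<close>; the supersolution is \<open>exp (- w)\<close>
  for a minimiser \<open>w\<close> of the resulting dual functional. Where the gradient of the test function does
  not vanish, the contact inequality is used for \<open>e\<close> along the gradient. At a critical point of the test function the inequality holds for \<open>e\<close> any unit eigenvector of the
  Hessian, which covers the largest and the smallest eigenvalue alike.
\<close>

lemma viscosity_supersolution_exists: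
  fixes p l :: real and \<Omega> :: "(real^'n::finite) set"
  assumes p: "1 < p" and \<Omega>: "open \<Omega>" "bounded \<Omega>" "\<Omega> \<noteq> {}"
    and l: "0 < l" "l < K_const CARD('n) p * measure lebesgue \<Omega> powr (- 2 / real CARD('n))"
  shows "\<exists>u. (\<forall>x\<in>\<Omega>. 0 < u x) \<and> viscosity_supersolution p l \<Omega> u"
proof -
  let ?n = "CARD('n)"
  define V where "V = measure lebesgue \<Omega>"
  define a where "a = (p - 1) / p"
  define c where "c = real ?n ^ ?n * (p - 1) / p ^ ?n"
  have a: "a > 0" and c: "c > 0" using p by (simp_all add: a_def c_def)
  have n: "real ?n > 0" by simp
  define g0 where "g0 \<xi> = c / (l + a * (norm \<xi>)\<^sup>2) ^ ?n" for \<xi> :: "real^'n"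
  have den: "l + a * (norm \<xi>)\<^sup>2 > 0" for \<xi> :: "real^'n" using l a by (simp add: add_pos_nonneg)
  have g0: "0 \<le> g0 \<xi>" for \<xi> using c den[of \<xi>] by (simp add: g0_def)
  have g0c: "continuous_on S g0" for S
    unfolding g0_def by (intro continuous_intros) (use den in \<open>auto simp: less_imp_neq[THEN not_sym]\<close>)
  have V: "V > 0" unfolding V_def by (rule measure_bounded_open_pos[OF \<Omega>])
  define Q where "Q = (pi / a) powr (?n / 2) * Gamma (?n / 2) / Gamma ?n"
  have KQ: "K_const ?n p powr (?n / 2) \<le> c * Q"
    using K_const_powr_le[OF p, of ?n] by (simp add: c_def Q_def a_def)
  have K: "K_const ?n p > 0" by (rule K_const_pos[OF p]) simp
  have mass: "(\<integral>\<^sup>+\<xi>. ennreal (g0 \<xi>) \<partial>lborel) = ennreal (c * Q / l powr (?n / 2))"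
  proof -
    have "(\<integral>\<^sup>+\<xi>. ennreal (g0 \<xi>) \<partial>lborel) = (\<integral>\<^sup>+\<xi>. ennreal c * ennreal (1 / (l + a * (norm (\<xi>::real^'n))\<^sup>2) ^ ?n) \<partial>lborel)"
      using c den by (intro nn_integral_cong) (simp add: g0_def ennreal_mult[symmetric] less_imp_le)
    also have "\<dots> = ennreal c * (\<integral>\<^sup>+\<xi>. ennreal (1 / (l + a * (norm (\<xi>::real^'n))\<^sup>2) ^ ?n) \<partial>lborel)"
      by (rule nn_integral_cmult) measurable
    also have "\<dots> = ennreal c * ennreal ((pi / (a * l)) powr (?n / 2) * Gamma (?n / 2) / Gamma ?n)"
      using nn_integral_inverse_quadratic_power[OF a l(1), where 'a = "real^'n"] by simp
    also have "\<dots> = ennreal (c * ((pi / (a * l)) powr (?n / 2) * Gamma (?n / 2) / Gamma ?n))"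
      using c by (intro ennreal_mult[symmetric]) (auto simp: Gamma_real_pos less_imp_le)
    also have "(pi / (a * l)) powr (?n / 2) = (pi / a) powr (?n / 2) / l powr (?n / 2)"
      using a l by (simp add: powr_divide powr_mult)
    finally show ?thesis by (simp add: Q_def mult.commute)
  qed
  have "V < c * Q / l powr (?n / 2)"
  proof -
    have "l powr (?n / 2) < (K_const ?n p * V powr (- 2 / ?n)) powr (?n / 2)"
      using l n by (intro powr_less_mono2) (auto simp: V_def)
    also have "\<dots> = K_const ?n p powr (?n / 2) / V"
      using K V by (simp add: powr_divide powr_powr powr_minus_divide)
    finally have "V * l powr (?n / 2) < K_const ?n p powr (?n / 2)"
      using V by (simp add: field_simps)
    then have "V * l powr (?n / 2) < c * Q" using KQ by simp
    then show ?thesis using l by (simp add: pos_less_divide_eq)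
  qed
  then have "ennreal V < (\<integral>\<^sup>+\<xi>. ennreal (g0 \<xi>) \<partial>lborel)"
    using V by (simp add: mass ennreal_less_iff)
  then obtain k :: nat where k: "V < integral (cball 0 (real k)) g0"
    using cball_integral_exceeds[OF g0c g0, of V] V by auto
  define C where "C = cball (0 :: real^'n) (real k)"
  \<comment> \<open>scaling the density down only strengthens the Monge-Ampere inequality\<close>
  define \<theta> where "\<theta> = V / integral C g0"
  have \<theta>: "0 < \<theta>" "\<theta> \<le> 1" "\<theta> * integral C g0 = V" using k V by (simp_all add: \<theta>_def C_def)
  define g where "g \<xi> = \<theta> * g0 \<xi>" for \<xi>
  have gc: "continuous_on S g" for S unfolding g_def by (intro continuous_intros g0c)
  have g_nonneg: "0 \<le> g \<xi>" for \<xi> using g0 \<theta> by (simp add: g_def)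
  interpret balanced_transport \<Omega> C g
  proof
    show "integral C g = measure lebesgue \<Omega>" using \<theta>(3) by (simp add: g_def[abs_def] V_def)
  qed (use \<Omega> gc g_nonneg in \<open>auto simp: C_def\<close>)
  have bt: "balanced_transport \<Omega> C g" by unfold_locales
  obtain h where h: "continuous_on C h"
    and min: "\<And>v. continuous_on (closure \<Omega>) v \<Longrightarrow> kantorovich_dual \<Omega> C g (legendre C h) \<le> kantorovich_dual \<Omega> C g v"
    by (rule kantorovich_dual_minimizer) blast
  define w where "w = legendre C h"
  define u where "u x = exp (- w x)" for x
  have wc: "continuous_on S w" for S unfolding w_def by (rule continuous_on_legendre[OF C h])
  have "viscosity_supersolution p l \<Omega> u"
    unfolding viscosity_supersolution_def
  proof (intro conjI ballI allI impI; (elim conjE)?)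
    show "lower_semicontinuous_on \<Omega> u"
      unfolding lower_semicontinuous_on_def
    proof (intro ballI allI impI)
      fix x b assume x: "x \<in> \<Omega>" and b: "b < u x"
      have "continuous_on \<Omega> u" unfolding u_def by (intro continuous_intros wc)
      then have "(u \<longlongrightarrow> u x) (at x within \<Omega>)" using x by (simp add: continuous_on_def)
      then show "\<forall>\<^sub>F y in at x within \<Omega>. b < u y" using b by (rule order_tendstoD)
    qed
  next
    fix x and \<phi> :: "real^'n \<Rightarrow> real"
    assume x: "x \<in> \<Omega>" and sm: "smooth_on \<Omega> \<phi>" and touch: "touches_from_below \<Omega> \<phi> u x"
    define H where "H = hessian \<phi> x"
    have \<phi>x: "\<phi> x = u x" using touch by (simp add: touches_from_below_def)
    then have pos: "\<phi> x > 0" by (simp add: u_def)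
    have isc: "isCont \<phi> y" if "y \<in> \<Omega>" for y
      by (rule has_derivative_continuous[OF smooth_on_derivatives(1)[OF sm \<Omega>(1) that]])
    have at: "at x within \<Omega> = at x" by (rule at_within_open[OF x \<Omega>(1)])
    have "\<forall>\<^sub>F y in at x. 0 < \<phi> y" using isc[OF x] pos unfolding isCont_def by (rule order_tendstoD)
    moreover have "\<forall>\<^sub>F y in at x. \<phi> y \<le> u y"
      using touch unfolding touches_from_below_def at by (auto elim!: eventually_mono)
    moreover have "\<forall>\<^sub>F y in at x. y \<in> \<Omega>" using \<Omega>(1) x by (rule eventually_at_in_open')
    ultimately have "\<forall>\<^sub>F y in at x. 0 < \<phi> y \<and> \<phi> y \<le> u y \<and> y \<in> \<Omega>" by eventually_elim auto
    then obtain r where r: "r > 0" "\<And>y. y \<noteq> x \<Longrightarrow> dist y x < r \<Longrightarrow> 0 < \<phi> y \<and> \<phi> y \<le> u y \<and> y \<in> \<Omega>"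
      unfolding eventually_at by blast
    have near: "0 < \<phi> y \<and> \<phi> y \<le> u y \<and> y \<in> \<Omega>" if "y \<in> ball x r" for y
      using r(2)[of y] that pos x \<phi>x by (cases "y = x") (auto simp: dist_commute)
    define G where "G y = - (1 / \<phi> y) *\<^sub>R grad \<phi> y" for y
    define M where "M y = outer_square ((1 / \<phi> y) *\<^sub>R grad \<phi> y) - (1 / \<phi> y) *\<^sub>R hessian \<phi> y" for y
    note sd = smooth_on_derivatives[OF sm \<Omega>(1)]
    have d\<psi>: "((\<lambda>y. - ln (\<phi> y)) has_derivative (\<lambda>h. G y \<bullet> h)) (at y)"
      and dG: "(G has_derivative (\<lambda>h. M y *v h)) (at y)" if "y \<in> ball x r" for y
      using derivatives_minus_ln[OF sd(1,2)] near[OF that] unfolding G_def[abs_def] M_def by auto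
    have gradc: "continuous_on (ball x r) (grad \<phi>)" and \<phi>c: "continuous_on (ball x r) \<phi>"
      using near has_derivative_continuous[OF sd(2)] isc by (auto intro!: continuous_at_imp_continuous_on)
    have Hc: "continuous_on (ball x r) (hessian \<phi>)"
      using continuous_on_hessian[OF sm] near continuous_on_subset by blast
    have Mc: "continuous_on (ball x r) M"
      unfolding M_def outer_square_def
      by (intro continuous_intros gradc \<phi>c Hc) (use near in force)+
    have touch': "legendre C h y \<le> - ln (\<phi> y)" if "y \<in> ball x r" for y
    proof -
      have "ln (\<phi> y) \<le> ln (u y)" using near[OF that] by simp
      then show ?thesis by (simp add: u_def w_def)
    qed
    have touchx: "- ln (\<phi> x) = legendre C h x" by (simp add: \<phi>x u_def w_def)
    have br: "ball x r \<subseteq> \<Omega>" using near by blast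
    note contact = minimizer_touching_jacobian[OF bt gc g_nonneg h min r(1) br d\<psi> dG Mc touch' touchx]
    have Gx: "G x = - (1 / \<phi> x) *\<^sub>R grad \<phi> x" by (simp add: G_def)
    have Mx: "M x = outer_square (G x) - (1 / \<phi> x) *\<^sub>R H"
      by (simp add: M_def G_def H_def outer_square_def vec_eq_iff)
    have "transpose H = H" unfolding H_def by (rule sd(3)[OF x])
    then have symM: "transpose (M x) = M x"
      by (simp add: Mx vec_eq_iff transpose_def outer_square_def mult.commute)
    have jac: "1 \<le> \<bar>det (M x)\<bar> * (\<theta> * (real ?n ^ ?n * (p - 1) / p ^ ?n / (l + (p - 1) / p * (norm (G x))\<^sup>2) ^ ?n))"
      using contact(2) unfolding g_def g0_def c_def a_def .
    have le: "l + (p - 1) / p * (norm (G x))\<^sup>2 \<le> (trace (M x) + (p - 2) * (e \<bullet> (M x *v e))) / p"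
      if "norm e = 1" for e
      by (rule minimizer_contact_inequality[OF p l(1) \<theta>(2) symM contact(1) jac that])
    have ineq: "l * \<phi> x \<le> - (1 / p) * trace H - (p - 2) / p * (e \<bullet> (H *v e))"
      if e: "norm e = 1" "(G x \<bullet> e)\<^sup>2 = (norm (G x))\<^sup>2" for e
      by (rule log_hessian_inequality[OF p pos _ e(2)]) (use le[OF e(1)] in \<open>simp only: Mx\<close>)
    have eigen: "l * \<phi> x \<le> - (1 / p) * laplacian \<phi> x - (p - 2) / p * m"
      if crit: "grad \<phi> x = 0" and m: "m \<in> real_eigenvalues H" for m
    proof -
      obtain e where "norm e = 1" "e \<bullet> (H *v e) = m" by (rule real_eigenvalue_unit_vector[OF m])
      then show ?thesis using ineq[of e] crit by (simp add: Gx laplacian_def H_def)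
    qed
    note ev = real_eigenvalues_symmetric[OF \<open>transpose H = H\<close>]
    show "l * \<phi> x \<le> - normalized_p_laplacian p \<phi> x" if nz: "grad \<phi> x \<noteq> 0"
    proof -
      let ?e = "(1 / norm (grad \<phi> x)) *\<^sub>R grad \<phi> x"
      have "l * \<phi> x \<le> - (1 / p) * trace H - (p - 2) / p * (?e \<bullet> (H *v ?e))"
        by (rule ineq) (use nz pos in \<open>simp_all add: Gx dot_square_norm power2_eq_square\<close>)
      moreover have "?e \<bullet> (H *v ?e) = ((H *v grad \<phi> x) \<bullet> grad \<phi> x) / (norm (grad \<phi> x))\<^sup>2"
        by (simp add: matrix_vector_mult_scaleR inner_commute power2_eq_square)
      ultimately have "l * \<phi> x \<le> - (1 / p) * trace H - (p - 2) / p * (((H *v grad \<phi> x) \<bullet> grad \<phi> x) / (norm (grad \<phi> x))\<^sup>2)"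
        by (simp only:)
      then show ?thesis by (simp add: normalized_p_laplacian_def H_def)
    qed
    show "l * \<phi> x \<le> - (1 / p) * laplacian \<phi> x - (p - 2) / p * min_eigenvalue (hessian \<phi> x)"
      if "grad \<phi> x = 0"
      using eigen[OF that Min_in[OF ev]] by (simp add: min_eigenvalue_def H_def)
    show "l * \<phi> x \<le> - (1 / p) * laplacian \<phi> x - (p - 2) / p * max_eigenvalue (hessian \<phi> x)"
      if "grad \<phi> x = 0"
      using eigen[OF that Max_in[OF ev]] by (simp add: max_eigenvalue_def H_def)
  qed
  then show ?thesis by (intro exI[of _ u]) (simp add: u_def)
qed

theorem theorem3:
  fixes p :: real and \<Omega> :: "(real^'n::finite) set"
  assumes "1 < p"
    and "open \<Omega>" and "bounded \<Omega>" and "connected \<Omega>" and "\<Omega> \<noteq> {}"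
  shows "first_eigenvalue p \<Omega>
           \<ge> ereal (K_const CARD('n) p * measure lebesgue \<Omega> powr (- 2 / real CARD('n)))"
proof -
  let ?c = "K_const CARD('n) p * measure lebesgue \<Omega> powr (- 2 / real CARD('n))"
  have le: "ereal l \<le> first_eigenvalue p \<Omega>" if "0 < l" "l < ?c" for l
    unfolding first_eigenvalue_def
    using viscosity_supersolution_exists[OF assms(1,2,3,5) that] by (intro Sup_upper) auto
  show ?thesis
  proof (rule dense_le_bounded)
    show "ereal 0 < ereal ?c"
      using K_const_pos[OF assms(1), of "CARD('n)"] measure_bounded_open_pos[OF assms(2,3,5)] by simp
  next
    fix z assume "ereal 0 < z" "z < ereal ?c"
    then show "z \<le> first_eigenvalue p \<Omega>" using le by (cases z) auto
  qed
qed

end
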